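(* Let $T>0$ and let $\varphi\in L^2(0,T)$. Then, in $L^2(0,T)$ (i.e. for almost every $t\in(0,T)$), $$\mathcal{H}_T\varphi(t)=-\frac{\cos\left(\pi\frac{t}{2T}\right)}{T}\ \mathrm{p.v.}\int_0^T\varphi(s)\,\frac{\sin\left(\pi\frac{s}{2T}\right)}{\cos^2\left(\pi\frac{s}{2T}\right)-\cos^2\left(\pi\frac{t}{2T}\right)}\,ds,$$ where $\mathcal{H}_T$ is the modified Hilbert transform on $(0,T)$ and the integral is a Cauchy principal value at $s=t$.
   Context: Modified Hilbert transform: every $\varphi\in L^2(0,T)$ has the Fourier expansion (convergent in $L^2(0,T)$) $\varphi(t)=\sum_{k=0}^\infty\varphi_k\sin\left(\left(\frac{\pi}{2}+k\pi\right)\frac{t}{T}\right)$ with $\varphi_k=\frac{2}{T}\int_0^T\varphi(s)\sin\left(\left(\frac{\pi}{2}+k\pi\right)\frac{s}{T}\right)ds$. The operator $\mathcal{H}_T:L^2(0,T)\to L^2(0,T)$ is defined by $\mathcal{H}_T\varphi(t)=\sum_{k=0}^\infty\varphi_k\cos\left(\left(\frac{\pi}{2}+k\pi\right)\frac{t}{T}\right)$, $t\in(0,T)$ (series in $L^2(0,T)$). The principal value is $\lim_{\varepsilon\to0^+}\int_{\{s\in(0,T):\,|s-t|>\varepsilon\}}$. *)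

theory Defs
  imports "HOL-Analysis.Analysis"
begin

text \<open>Elements of \<open>L\<^sup>2(0,T)\<close> are represented by real functions on the line, of which only the
  restriction to \<open>(0,T)\<close> matters; equality in \<open>L\<^sup>2(0,T)\<close> is equality almost everywhere on \<open>(0,T)\<close>.\<close>

definition L2_space :: "real \<Rightarrow> (real \<Rightarrow> real) set" where
  "L2_space T = {f. f \<in> borel_measurable (lebesgue_on {0<..<T}) \<and>
                    integrable (lebesgue_on {0<..<T}) (\<lambda>t. (f t)\<^sup>2)}"

definition L2_norm :: "real \<Rightarrow> (real \<Rightarrow> real) \<Rightarrow> real" where
  "L2_norm T f = sqrt (integral\<^sup>L (lebesgue_on {0<..<T}) (\<lambda>t. (f t)\<^sup>2))"

definition L2_sums :: "real \<Rightarrow> (nat \<Rightarrow> real \<Rightarrow> real) \<Rightarrow> (real \<Rightarrow> real) \<Rightarrow> bool" where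
  "L2_sums T u f \<longleftrightarrow> (\<forall>k. u k \<in> L2_space T) \<and> f \<in> L2_space T \<and>
     (\<lambda>n. L2_norm T (\<lambda>t. (\<Sum>k<n. u k t) - f t)) \<longlonglongrightarrow> 0"

definition sine_coeff :: "real \<Rightarrow> (real \<Rightarrow> real) \<Rightarrow> nat \<Rightarrow> real" where
  "sine_coeff T \<phi> k = 2 / T *
     integral\<^sup>L (lebesgue_on {0<..<T}) (\<lambda>s. \<phi> s * sin ((pi / 2 + real k * pi) * (s / T)))"

text \<open>The sum of the cosine series is determined only up to a null set; the operator picks some
  representative.\<close>

definition modified_Hilbert :: "real \<Rightarrow> (real \<Rightarrow> real) \<Rightarrow> real \<Rightarrow> real" where
  "modified_Hilbert T \<phi> =
     (SOME h. L2_sums T (\<lambda>k t. sine_coeff T \<phi> k * cos ((pi / 2 + real k * pi) * (t / T))) h)"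

text \<open>The integrability requirement rules out truncated integrals that take the value 0 only because
  the Bochner integral of a non-integrable function is 0 by convention.\<close>

definition has_pv_integral :: "(real \<Rightarrow> real) \<Rightarrow> real \<Rightarrow> real set \<Rightarrow> real \<Rightarrow> bool" where
  "has_pv_integral f I S c \<longleftrightarrow>
     (\<forall>\<epsilon>>0. integrable (lebesgue_on {s \<in> S. \<epsilon> < \<bar>s - c\<bar>}) f) \<and>
     ((\<lambda>\<epsilon>. integral\<^sup>L (lebesgue_on {s \<in> S. \<epsilon> < \<bar>s - c\<bar>}) f) \<longlongrightarrow> I) (at_right 0)"

end

theory Submission
  imports Defs
begin

text \<open>Since
  \<open>cos b sin a / (cos\<^sup>2 a - cos\<^sup>2 b) = - (1 / sin (a - b) + 1 / sin (a + b)) / 2\<close>, the claim is a statement about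
  a truncated conjugate-function integral. The Abel means of the cosine series have two descriptions: as
  Poisson integrals of its \<open>L\<^sup>2\<close> sum \<open>h\<close>, and as conjugate Poisson integrals of \<open>\<phi>\<close>. The former tend to
  \<open>h t\<close> at every Lebesgue point of \<open>h\<close>. The latter differ from the integral truncated at distance \<open>d\<close> by
  an integral of \<open>\<phi>\<close> against a kernel that is \<open>O(d / (d\<^sup>2 + (s - t)\<^sup>2))\<close> with total mass tending
  to 0 (it is odd about \<open>t\<close> up to \<open>o(1)\<close>), so they have the same limit at every Lebesgue point of \<open>\<phi>\<close>.
  No maximal function is needed, because \<open>h\<close> is known to exist in \<open>L\<^sup>2\<close> beforehand.\<close>

subsection \<open>Lebesgue points\<close>

text \<open>The Abel parameter is tied to the truncation radius. With \<sigma> = d/T, the number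
  \<rho> = sqrt(1 + \<sigma>^2) - \<sigma> solves 1/\<rho> - \<rho> = 2\<sigma>, so both kernels get
  the denominator 2(\<sigma>^2 + sin^2), and Jordan's inequality bounds \<sigma>^2 + sin^2 below by
  (d^2 + (s - t)^2)/T^2. One majorant therefore serves the Poisson kernel and the truncation error
  alike. The obstacle is that the integral of this majorant stays bounded but does not vanish with
  d, so size estimates alone would leave an error proportional to the value of \<phi> at t.
  Cancellation removes it: the term in s - t is odd about t, hence integrates to 0 over a symmetric
  neighbourhood, while the term in s + t is regular on the interval for fixed t and its error has
  integral O(d). The functions \<phi> and h are linked only through their coefficients: integrating
  h against the k-th cosine gives the same number as integrating \<phi> against the k-th sine.
  Bessel's inequality and completeness supply h. The total mass T of the Poisson kernel is the
  source of the factor 1/T in the formula.\<close>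

text \<open>Differentiability of the indefinite integral via the Henstock lemma: on a disjoint Vitali family of
  bad intervals tagged at their centres the Riemann sums would miss the integral by too much.\<close>

lemma negligible_bad_averages:
  fixes f :: "real \<Rightarrow> real"
  assumes f: "f integrable_on {a..b}" and e: "0 < e"
  shows "negligible {x \<in> {a<..<b}. \<forall>d>0. \<exists>r. 0 < r \<and> r < d \<and>
           e * r \<le> \<bar>2 * r * f x - integral {x-r..x+r} f\<bar>}" (is "negligible ?S")
proof -
  have "\<exists>U. ?S \<subseteq> U \<and> U \<in> lmeasurable \<and> measure lebesgue U \<le> \<eta>" if \<eta>: "0 < \<eta>" for \<eta>
  proof -
    \<comment> \<open>The tolerance is fixed backwards: each bad interval of radius r misses by at
      least e times r, so the radii of a disjoint family add up to less than \<eta>/2 and the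
      lengths to less than \<eta>.\<close>
    obtain \<gamma> where \<gamma>: "gauge \<gamma>"
      and hen: "\<And>p. \<lbrakk>p tagged_partial_division_of (cbox a b); \<gamma> fine p\<rbrakk> \<Longrightarrow>
             sum (\<lambda>(x,k). norm(measure lborel k *\<^sub>R f x - integral k f)) p < e * \<eta> / 2"
      using Henstock_lemma[of f a b "e * \<eta> / 2"] f e \<eta> by auto
    define K where "K = {(x, r). x \<in> ?S \<and> 0 < r \<and> cball x r \<subseteq> {a..b} \<and> cball x r \<subseteq> \<gamma> x \<and>
                      e * r \<le> \<bar>2 * r * f x - integral {x-r..x+r} f\<bar>}"
    have cover: "\<exists>i. i \<in> K \<and> x \<in> cball (fst i) (snd i) \<and> snd i < d" if x: "x \<in> ?S" and d: "0 < d" for x d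
    proof -
      have "open (\<gamma> x \<inter> {a<..<b})" "x \<in> \<gamma> x \<inter> {a<..<b}"
        using \<gamma> x by (auto simp: gauge_def)
      then obtain d' where d': "d' > 0" "cball x d' \<subseteq> \<gamma> x \<inter> {a<..<b}"
        using open_contains_cball by blast
      obtain r where r: "0 < r" "r < min d d'" "e * r \<le> \<bar>2 * r * f x - integral {x-r..x+r} f\<bar>"
      proof -
        have "\<forall>d>0. \<exists>r. 0 < r \<and> r < d \<and> e * r \<le> \<bar>2 * r * f x - integral {x-r..x+r} f\<bar>"
          using x by blast
        from this[rule_format, of "min d d'"] show ?thesis using d d' that by auto
      qed
      have sub: "cball x r \<subseteq> cball x d'" using r by auto
      have "{a<..<b} \<subseteq> {a..b}" by auto
      with sub d'(2) have "cball x r \<subseteq> {a..b}" "cball x r \<subseteq> \<gamma> x" by blast+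
      then have "(x, r) \<in> K"
        unfolding K_def using x r by simp
      then show ?thesis using r by (intro exI[of _ "(x, r)"]) auto
    qed
    obtain C where C: "countable C" "C \<subseteq> K"
      and dj: "pairwise (\<lambda>i j. disjnt (cball (fst i) (snd i)) (cball (fst j) (snd j))) C"
      and neg: "negligible (?S - (\<Union>i \<in> C. cball (fst i) (snd i)))"
    proof (rule Vitali_covering_theorem_cballs[of K snd ?S fst])
      show "\<And>i. i \<in> K \<Longrightarrow> 0 < snd i" by (auto simp: K_def)
    qed (use cover in auto)
    let ?D = "(\<lambda>i. cball (fst i) (snd i)) ` C"
    \<comment> \<open>Only a finite subfamily is a tagged partial division. Bounds that are uniform
      over finite subfamilies pass to the countable union.\<close>
    have bound: "measure lebesgue (\<Union>\<E>) \<le> \<eta>" if \<E>: "\<E> \<subseteq> ?D" "finite \<E>" for \<E>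
    proof -
      obtain F where F: "F \<subseteq> C" "finite F" "\<E> = (\<lambda>i. cball (fst i) (snd i)) ` F"
        using \<E> by (meson finite_subset_image)
      have cb: "cball (x::real) r = {x-r..x+r}" for x r by (auto simp: cball_eq_atLeastAtMost)
      define p where "p = (\<lambda>(x, r). (x, {x-r..x+r})) ` F"
      have inj: "inj_on (\<lambda>(x, r). (x, {x-r..x+r})) F"
      proof (rule inj_onI)
        fix i j assume ij: "i \<in> F" "j \<in> F" "(\<lambda>(x, r). (x, {x-r..x+r})) i = (\<lambda>(x, r). (x, {x-r..x+r})) j"
        have "0 < snd i" "0 < snd j" using ij F C by (auto simp: K_def)
        then show "i = j" using ij(3) by (auto simp: prod_eq_iff split: prod.splits)
      qed
      have p: "p tagged_partial_division_of (cbox a b)"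
        unfolding tagged_partial_division_of_def
      proof (intro conjI allI impI)
        show "finite p" using F by (simp add: p_def)
      next
        fix x k assume "(x, k) \<in> p"
        then obtain r where r: "(x, r) \<in> F" "k = {x-r..x+r}" by (auto simp: p_def)
        then have "(x, r) \<in> K" using F C by blast
        then have "0 < r" "{x-r..x+r} \<subseteq> {a..b}" by (simp_all only: K_def cb mem_Collect_eq split)
        then show "x \<in> k" "k \<subseteq> cbox a b" "\<exists>a b. k = cbox a b" using r by auto
      next
        fix x1 K1 x2 K2 assume *: "(x1, K1) \<in> p \<and> (x2, K2) \<in> p \<and> (x1, K1) \<noteq> (x2, K2)"
        then obtain r1 r2 where r: "(x1, r1) \<in> F" "K1 = {x1-r1..x1+r1}" "(x2, r2) \<in> F" "K2 = {x2-r2..x2+r2}"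
          by (auto simp: p_def)
        then have "disjnt (cball x1 r1) (cball x2 r2)"
          using pairwiseD[OF dj, of "(x1,r1)" "(x2,r2)"] * F by auto
        then show "interior K1 \<inter> interior K2 = {}"
          unfolding r(2,4) cb[symmetric] disjnt_def using interior_subset by blast
      qed
      have fine: "\<gamma> fine p"
        unfolding fine_def
      proof clarify
        fix x k y assume "(x, k) \<in> p" and y: "y \<in> k"
        then obtain r where r: "(x, r) \<in> F" "k = {x-r..x+r}" by (auto simp: p_def)
        then have "(x, r) \<in> K" using F C by blast
        then show "y \<in> \<gamma> x" using r y unfolding K_def cb by auto
      qed
      have pos: "0 < snd i" if "i \<in> F" for i using that F C by (auto simp: K_def)
      have "e * (\<Sum>i\<in>F. snd i) = (\<Sum>i\<in>F. e * snd i)" by (simp add: sum_distrib_left)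
      also have "\<dots> \<le> (\<Sum>(x, r)\<in>F. \<bar>2 * r * f x - integral {x-r..x+r} f\<bar>)"
        using F C by (intro sum_mono) (auto simp: K_def)
      also have "\<dots> = (\<Sum>(x, r)\<in>F. norm (measure lborel {x-r..x+r} *\<^sub>R f x - integral {x-r..x+r} f))"
        using pos by (intro sum.cong) force+
      also have "\<dots> = sum (\<lambda>(x,k). norm(measure lborel k *\<^sub>R f x - integral k f)) p"
        unfolding p_def by (subst sum.reindex[OF inj]) (simp add: split_def o_def)
      also have "\<dots> < e * \<eta> / 2" by (rule hen[OF p fine])
      finally have "e * (\<Sum>i\<in>F. snd i) < e * (\<eta> / 2)" by simp
      then have *: "(\<Sum>i\<in>F. snd i) < \<eta> / 2" using e by (simp add: mult_less_cancel_left_pos)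
      have "measure lebesgue (\<Union>\<E>) \<le> (\<Sum>i\<in>F. measure lebesgue (cball (fst i) (snd i)))"
        unfolding F(3) by (rule measure_UNION_le) (use F in auto)
      also have "\<dots> = (\<Sum>i\<in>F. 2 * snd i)"
        using pos by (intro sum.cong) (force simp: cb)+
      finally show ?thesis using * by (simp add: sum_distrib_left[symmetric])
    qed
    have *: "\<Union>?D \<in> lmeasurable" "measure lebesgue (\<Union>?D) \<le> \<eta>"
    proof -
      have m: "D \<in> lmeasurable" if "D \<in> ?D" for D using that by auto
      show "\<Union>?D \<in> lmeasurable" by (rule fmeasurable_Union_bound[OF countable_image[OF C(1)] m bound])
      show "measure lebesgue (\<Union>?D) \<le> \<eta>" by (rule measure_Union_bound[OF countable_image[OF C(1)] m bound])
    qed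
    let ?N = "?S - \<Union>?D"
    have N: "?N \<in> null_sets lebesgue" using neg by (simp add: negligible_iff_null_sets)
    show ?thesis
    proof (intro exI[of _ "\<Union>?D \<union> ?N"] conjI)
      show "?S \<subseteq> \<Union>?D \<union> ?N" by blast
      show "\<Union>?D \<union> ?N \<in> lmeasurable"
        by (rule fmeasurable.Un[OF *(1) negligible_imp_measurable[OF neg]])
      have "measure lebesgue (\<Union>?D \<union> ?N) = measure lebesgue (\<Union>?D)"
        by (rule measure_Un_null_set[OF fmeasurableD[OF *(1)] N])
      then show "measure lebesgue (\<Union>?D \<union> ?N) \<le> \<eta>" using * by simp
    qed
  qed
  then show ?thesis by (simp add: negligible_outer_le)
qed

text \<open>Lebesgue differentiation with centred intervals. Failure of convergence at a point is
  failure at some level 1/(n+1), so the exceptional set is a countable union of the sets treated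
  above.\<close>

theorem negligible_not_average_tendsto:
  fixes f :: "real \<Rightarrow> real"
  assumes f: "f integrable_on {a..b}"
  shows "negligible {x \<in> {a<..<b}. \<not> ((\<lambda>r. integral {x-r..x+r} f / (2 * r)) \<longlongrightarrow> f x) (at_right 0)}"
    (is "negligible ?N")
proof -
  let ?S = "\<lambda>e. {x \<in> {a<..<b}. \<forall>d>0. \<exists>r. 0 < r \<and> r < d \<and>
           e * r \<le> \<bar>2 * r * f x - integral {x-r..x+r} f\<bar>}"
  have "?N \<subseteq> (\<Union>n. ?S (inverse (real (Suc n))))"
  proof
    fix x assume x: "x \<in> ?N"
    then have "\<not> ((\<lambda>r. integral {x-r..x+r} f / (2 * r)) \<longlongrightarrow> f x) (at_right 0)" by blast
    then obtain e where e: "e > 0" and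
      *: "\<not> eventually (\<lambda>r. dist (integral {x-r..x+r} f / (2 * r)) (f x) < e) (at_right 0)"
      by (auto simp: tendsto_iff)
    obtain n where n: "inverse (real (Suc n)) < e" using reals_Archimedean[OF e] by blast
    have "\<exists>r. 0 < r \<and> r < d \<and> inverse (real (Suc n)) * r \<le> \<bar>2 * r * f x - integral {x-r..x+r} f\<bar>" if d: "d > 0" for d
    proof -
      obtain r where r: "0 < r" "r < d" "\<not> dist (integral {x-r..x+r} f / (2 * r)) (f x) < e"
        using * d unfolding eventually_at_right_field by (metis)
      have "e \<le> \<bar>integral {x-r..x+r} f / (2 * r) - f x\<bar>" using r by (simp add: dist_real_def)
      also have "integral {x-r..x+r} f / (2 * r) - f x = (integral {x-r..x+r} f - 2 * r * f x) / (2 * r)"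
        using r by (simp add: field_simps)
      finally have "e * (2 * r) \<le> \<bar>2 * r * f x - integral {x-r..x+r} f\<bar>"
        using r by (simp add: abs_divide pos_le_divide_eq)
      moreover have "inverse (real (Suc n)) * r \<le> e * (2 * r)"
        using n r e by (intro mult_mono) auto
      ultimately show ?thesis using r by (intro exI[of _ r]) linarith
    qed
    then show "x \<in> (\<Union>n. ?S (inverse (real (Suc n))))" using x by blast
  qed
  moreover have "negligible (\<Union>n. ?S (inverse (real (Suc n))))"
  proof (intro negligible_countable_Union)
    fix S assume "S \<in> range (\<lambda>n. ?S (inverse (real (Suc n))))"
    then obtain n where "S = ?S (inverse (real (Suc n)))" by blast
    then show "negligible S" using negligible_bad_averages[OF f, of "inverse (real (Suc n))"] by simp
  qed simp
  ultimately show ?thesis by (rule negligible_subset[rotated])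
qed

text \<open>The number \<open>f x\<close> varies with the point, so differentiation cannot be
  applied to the deviation from it directly. It is applied to \<open>g q\<close> for all rational q
  at once, off a single null set, and q is then chosen close to \<open>f x\<close>.\<close>

theorem AE_Lebesgue_point:
  fixes f :: "real \<Rightarrow> real"
  assumes f: "integrable (lebesgue_on {a<..<b}) f"
  shows "AE x in lebesgue_on {a<..<b}.
    ((\<lambda>r. (\<integral>s. indicator {x-r..x+r} s * \<bar>f s - f x\<bar> \<partial>lebesgue_on {a<..<b}) / r) \<longlongrightarrow> 0) (at_right 0)"
proof -
  let ?M = "lebesgue_on {a<..<b}"
  define g where "g q s = \<bar>f s - q\<bar>" for q s
  have fin: "finite_measure ?M" by (rule finite_measure_lebesgue_on) simp
  have const: "integrable ?M (\<lambda>s. q)" for q :: real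
    using fin by (simp add: finite_measure.integrable_const)
  have g: "integrable ?M (g q)" for q
    unfolding g_def using f const by (intro integrable_abs Bochner_Integration.integrable_diff)
  have avg: "negligible {x \<in> {a<..<b}. \<not> ((\<lambda>r. integral {x-r..x+r} (g q) / (2 * r)) \<longlongrightarrow> g q x) (at_right 0)}" for q
  proof (rule negligible_not_average_tendsto)
    have "g q integrable_on {a<..<b}" using g by (rule integrable_on_lebesgue_on) simp
    then show "g q integrable_on {a..b}" using integrable_on_open_interval_real by blast
  qed
  have "negligible (\<Union>q\<in>\<rat>. {x \<in> {a<..<b}. \<not> ((\<lambda>r. integral {x-r..x+r} (g q) / (2 * r)) \<longlongrightarrow> g q x) (at_right 0)})"
    by (intro negligible_countable_Union) (use avg countable_rat in auto)
  then have "AE x in lebesgue. x \<notin> (\<Union>q\<in>\<rat>. {x \<in> {a<..<b}. \<not> ((\<lambda>r. integral {x-r..x+r} (g q) / (2 * r)) \<longlongrightarrow> g q x) (at_right 0)})"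
    by (intro AE_not_in) (simp add: negligible_iff_null_sets)
  then have ae: "AE x in lebesgue. x \<in> {a<..<b} \<longrightarrow> (\<forall>q\<in>\<rat>. ((\<lambda>r. integral {x-r..x+r} (g q) / (2 * r)) \<longlongrightarrow> g q x) (at_right 0))"
    by eventually_elim blast
  have main: "((\<lambda>r. (\<integral>s. indicator {x-r..x+r} s * \<bar>f s - f x\<bar> \<partial>?M) / r) \<longlongrightarrow> 0) (at_right 0)"
    if x: "x \<in> {a<..<b}" and
      lim: "\<forall>q\<in>\<rat>. ((\<lambda>r. integral {x-r..x+r} (g q) / (2 * r)) \<longlongrightarrow> g q x) (at_right 0)" for x
  proof (rule tendstoI)
    fix e :: real assume e: "e > 0"
    \<comment> \<open>On an interval of length 2r, the average of \<open>g q\<close> and the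
      replacement of q by \<open>f x\<close> each cost at most 2r times e/8, together half of the
      allowed e times r.\<close>
    obtain q where q: "q \<in> \<rat>" "f x - e / 8 < q" "q < f x + e / 8"
      using Rats_dense_in_real[of "f x - e / 8" "f x + e / 8"] e by auto
    have gq: "g q x < e / 8" unfolding g_def using q by linarith
    have "eventually (\<lambda>r. integral {x-r..x+r} (g q) / (2 * r) < e / 8) (at_right 0)"
      using order_tendstoD(2)[OF bspec[OF lim q(1)] gq] .
    moreover have "eventually (\<lambda>r. r \<in> {0<..<min (x - a) (b - x)}) (at_right 0)"
      by (rule eventually_at_rightI[of _ "min (x - a) (b - x)"]) (use x in auto)
    ultimately show "eventually (\<lambda>r. dist ((\<integral>s. indicator {x-r..x+r} s * \<bar>f s - f x\<bar> \<partial>?M) / r) 0 < e) (at_right 0)"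
    proof eventually_elim
      case (elim r)
      then have r: "0 < r" "{x-r..x+r} \<subseteq> {a<..<b}" by auto
      let ?I = "{x-r..x+r}"
      have ind: "integrable ?M (\<lambda>s. indicator ?I s * h s)" if "integrable ?M h" for h :: "real \<Rightarrow> real"
        using that integrable_real_mult_indicator[of ?I ?M h] r(2)
        by (simp add: mult.commute sets_restrict_space_iff)
      have "(\<integral>s. indicator ?I s * \<bar>f s - f x\<bar> \<partial>?M) \<le> (\<integral>s. indicator ?I s * (g q s + e / 8) \<partial>?M)"
      proof (rule integral_mono)
        fix s show "indicator ?I s * \<bar>f s - f x\<bar> \<le> indicator ?I s * (g q s + e / 8)"
          unfolding g_def by (intro mult_left_mono) (use q in linarith, simp)
      qed (use f const g in \<open>auto intro!: ind integrable_abs Bochner_Integration.integrable_diff Bochner_Integration.integrable_add\<close>)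
      also have "\<dots> = (\<integral>s. indicator ?I s * g q s \<partial>?M) + (\<integral>s. indicator ?I s * (e / 8) \<partial>?M)"
        using ind[OF g] ind[OF const] by (simp add: distrib_left)
      \<comment> \<open>The passage from the Bochner integral to the gauge integral is proved for
        general h because it is applied twice, to \<open>g q\<close> and to the constant
        e/8.\<close>
      also have "(\<integral>s. indicator ?I s * h s \<partial>?M) = integral ?I h" if "integrable ?M h" for h :: "real \<Rightarrow> real"
      proof -
        have i: "integrable lebesgue (\<lambda>s. indicator {a<..<b} s *\<^sub>R (indicator ?I s * h s))"
          using ind[OF that] by (simp add: integrable_restrict_space)
        have eq: "(\<lambda>s. indicator {a<..<b} s *\<^sub>R (indicator ?I s * h s)) = (\<lambda>s. indicator ?I s *\<^sub>R h s)"
          by (rule ext) (use r(2) in \<open>auto split: split_indicator\<close>)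
        have "(\<integral>s. indicator ?I s * h s \<partial>?M) = (\<integral>s. indicator ?I s *\<^sub>R h s \<partial>lebesgue)"
          by (simp only: integral_restrict_space space_completion space_lborel sets.Int_space_eq2 eq[symmetric]) (simp add: integral_restrict_space)
        also have "\<dots> = integral ?I h"
          using i unfolding eq by (intro set_lebesgue_integral_eq_integral(2)[unfolded set_lebesgue_integral_def set_integrable_def])
        finally show ?thesis .
      qed
      note this[OF g, of q]
      also have "(\<integral>s. indicator ?I s * (e / 8) \<partial>?M) = integral ?I (\<lambda>s. e / 8)"
        using \<open>\<And>h. integrable ?M h \<Longrightarrow> (\<integral>s. indicator ?I s * h s \<partial>?M) = integral ?I h\<close>[OF const] .
      finally have "(\<integral>s. indicator ?I s * \<bar>f s - f x\<bar> \<partial>?M) \<le> integral ?I (g q) + 2 * r * (e / 8)"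
        using r by simp
      also have "integral ?I (g q) < 2 * r * (e / 8)" using elim r by (simp add: field_simps)
      finally have "(\<integral>s. indicator ?I s * \<bar>f s - f x\<bar> \<partial>?M) < e * r" using r e by (simp add: field_simps) (smt (verit) mult_pos_pos)
      then have "(\<integral>s. indicator ?I s * \<bar>f s - f x\<bar> \<partial>?M) / r < e" using r by (simp add: pos_divide_less_eq)
      moreover have "0 \<le> (\<integral>s. indicator ?I s * \<bar>f s - f x\<bar> \<partial>?M)" by (rule Bochner_Integration.integral_nonneg) simp
      ultimately show ?case using r by (simp add: dist_real_def)
    qed
  qed
  have "AE x in lebesgue. x \<in> {a<..<b} \<longrightarrow> ((\<lambda>r. (\<integral>s. indicator {x-r..x+r} s * \<bar>f s - f x\<bar> \<partial>?M) / r) \<longlongrightarrow> 0) (at_right 0)"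
    using ae by eventually_elim (use main in blast)
  then show ?thesis by (simp add: AE_restrict_space_iff)
qed

subsection \<open>Approximate identities with a Poisson majorant\<close>

lemma geometric_half_sum_le: "(\<Sum>j\<le>J. (1/2::real) ^ j) \<le> 2"
proof -
  have "(\<Sum>j\<le>J. (1/2::real) ^ j) = 2 - (1/2) ^ J" by (induction J) simp_all
  then show ?thesis by simp
qed

text \<open>Dyadic shells: where the distance to t is about 2^j d the kernel is at most 4/(4^j d),
  while g has mass at most e 2^j d there. The products form a geometric series with sum at most 8e.
  Beyond a fixed distance \<delta> the kernel is at most d/\<delta>^2, which vanishes with
  d.\<close>

lemma integral_Poisson_majorant_tendsto_0:
  fixes g :: "real \<Rightarrow> real"
  assumes g: "integrable (lebesgue_on {a<..<b}) g" and nn: "\<And>s. 0 \<le> g s"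
    and lim: "((\<lambda>r. (\<integral>s. indicator {t-r..t+r} s * g s \<partial>lebesgue_on {a<..<b}) / r) \<longlongrightarrow> 0) (at_right 0)"
  shows "((\<lambda>d. \<integral>s. d / (d\<^sup>2 + (s - t)\<^sup>2) * g s \<partial>lebesgue_on {a<..<b}) \<longlongrightarrow> 0) (at_right 0)"
proof (rule tendstoI)
  let ?M = "lebesgue_on {a<..<b}"
  let ?G = "\<lambda>r. \<integral>s. indicator {t-r..t+r} s * g s \<partial>?M"
  fix e0 :: real assume e0: "0 < e0"
  \<comment> \<open>The shells cost 8e and the far part less than e, which leaves room below
    10e.\<close>
  define e where "e = e0 / 10"
  have e: "0 < e" using e0 by (simp add: e_def)
  have "eventually (\<lambda>r. ?G r / r < e) (at_right 0)" using order_tendstoD(2)[OF lim e] .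
  then obtain \<delta>1 where \<delta>1: "\<delta>1 > 0" "\<And>r. 0 < r \<Longrightarrow> r < \<delta>1 \<Longrightarrow> ?G r / r < e"
    unfolding eventually_at_right_field by auto
  define \<delta> where "\<delta> = \<delta>1 / 2"
  have \<delta>: "\<delta> > 0" and Gle: "\<And>r. 0 < r \<Longrightarrow> r \<le> \<delta> \<Longrightarrow> ?G r \<le> e * r"
    using \<delta>1 by (auto simp: \<delta>_def pos_divide_less_eq less_imp_le)
  define A where "A = (\<integral>s. g s \<partial>?M)"
  have A: "0 \<le> A" unfolding A_def by (rule Bochner_Integration.integral_nonneg) (rule nn)
  have meas_ind [measurable]: "indicat_real {u..v} \<in> borel_measurable ?M" for u v :: real
    by (rule measurable_restrict_space1, rule borel_measurable_indicator) simp
  have ind: "integrable ?M (\<lambda>s. indicator {u..v} s * g s)" for u v :: real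
    by (rule Bochner_Integration.integrable_bound[OF g]) (use g in \<open>auto split: split_indicator\<close>)
  have key: "(\<integral>s. d / (d\<^sup>2 + (s - t)\<^sup>2) * g s \<partial>?M) \<le> 8 * e + d / \<delta>\<^sup>2 * A" if d: "0 < d" for d
  proof -
    obtain J where J: "\<delta> / d < 2 ^ J" using real_arch_pow[of 2 "\<delta> / d"] by auto
    \<comment> \<open>The radii are capped at \<delta> because the averages of g are known to be
      small only up to there; J is large enough for the last shell to reach \<delta>.\<close>
    define \<rho> where "\<rho> j = min (2 ^ j * d) \<delta>" for j :: nat
    have \<rho>: "0 < \<rho> j" "\<rho> j \<le> \<delta>" "\<rho> j \<le> 2 ^ j * d" for j using d \<delta> by (auto simp: \<rho>_def)
    define R where "R s = (\<Sum>j\<le>J. 4 / (4 ^ j * d) * (indicator {t-\<rho> j..t+\<rho> j} s * g s)) + d / \<delta>\<^sup>2 * g s" for s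
    have Ri: "integrable ?M R"
      unfolding R_def using g ind by (intro Bochner_Integration.integrable_add Bochner_Integration.integrable_sum integrable_mult_right) auto
    have sumnn: "0 \<le> (\<Sum>j\<le>J. 4 / (4 ^ j * d) * (indicator {t-\<rho> j..t+\<rho> j} s * g s))" for s
      using d nn by (intro sum_nonneg mult_nonneg_nonneg) auto
    have pos: "0 < d\<^sup>2 + (s - t)\<^sup>2" for s using d by (simp add: add_pos_nonneg)
    have pw: "d / (d\<^sup>2 + (s - t)\<^sup>2) * g s \<le> R s" for s
    proof (cases "\<bar>s - t\<bar> \<le> \<delta>")
      case False
      then have "\<delta>\<^sup>2 \<le> (s - t)\<^sup>2" using \<delta> by (intro abs_le_square_iff[THEN iffD1]) auto
      then have "d / (d\<^sup>2 + (s - t)\<^sup>2) \<le> d / \<delta>\<^sup>2"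
        using d \<delta> by (intro divide_left_mono) (auto simp: add_pos_nonneg intro: add_increasing)
      then have "d / (d\<^sup>2 + (s - t)\<^sup>2) * g s \<le> d / \<delta>\<^sup>2 * g s" using nn by (rule mult_right_mono)
      then show ?thesis using sumnn[of s] by (simp add: R_def)
    next
      case True
      \<comment> \<open>The index of the shell containing s. Minimality says that s lies outside the
        previous shell, and this shift by one index is where the factor 4 comes from.\<close>
      define j where "j = (LEAST j. \<bar>s - t\<bar> \<le> 2 ^ j * d)"
      have "\<bar>s - t\<bar> \<le> 2 ^ J * d" using True J d by (simp add: field_simps)
      then have j: "\<bar>s - t\<bar> \<le> 2 ^ j * d" "j \<le> J"
        unfolding j_def by (rule LeastI, rule Least_le)
      have b: "d / (d\<^sup>2 + (s - t)\<^sup>2) \<le> 4 / (4 ^ j * d)"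
      proof (cases j)
        case 0
        have "d / (d\<^sup>2 + (s - t)\<^sup>2) \<le> d / d\<^sup>2"
          using d by (intro divide_left_mono) (auto simp: add_pos_nonneg)
        also have "\<dots> \<le> 4 / d" using d by (simp add: power2_eq_square field_simps)
        finally show ?thesis using 0 by simp
      next
        case (Suc i)
        then have "\<not> \<bar>s - t\<bar> \<le> 2 ^ i * d"
          unfolding j_def using not_less_Least[of i "\<lambda>j. \<bar>s - t\<bar> \<le> 2 ^ j * d"] by simp
        then have "(2 ^ i * d)\<^sup>2 \<le> (s - t)\<^sup>2" using d by (intro abs_le_square_iff[THEN iffD1]) auto
        then have le: "4 ^ i * d\<^sup>2 \<le> (s - t)\<^sup>2"
          by (simp add: power_mult_distrib power_mult[symmetric] mult.commute[of i]) (simp add: power_mult)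
        have "d / (d\<^sup>2 + (s - t)\<^sup>2) \<le> d / (4 ^ i * d\<^sup>2)"
          using d le by (intro divide_left_mono) (auto simp: add_pos_nonneg intro: add_increasing)
        also have "\<dots> = 4 / (4 ^ j * d)" using d Suc by (simp add: power2_eq_square field_simps)
        finally show ?thesis .
      qed
      have in_ind: "s \<in> {t-\<rho> j..t+\<rho> j}"
        using j(1) True unfolding \<rho>_def by (auto simp: abs_le_iff min_def)
      have "d / (d\<^sup>2 + (s - t)\<^sup>2) * g s \<le> 4 / (4 ^ j * d) * g s" using b nn by (rule mult_right_mono)
      also have "\<dots> = 4 / (4 ^ j * d) * (indicator {t-\<rho> j..t+\<rho> j} s * g s)" using in_ind by simp
      also have "\<dots> \<le> (\<Sum>j\<le>J. 4 / (4 ^ j * d) * (indicator {t-\<rho> j..t+\<rho> j} s * g s))"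
        using j(2) d nn by (intro member_le_sum) auto
      also have "\<dots> \<le> R s" using d nn by (simp add: R_def)
      finally show ?thesis .
    qed
    have "(\<integral>s. d / (d\<^sup>2 + (s - t)\<^sup>2) * g s \<partial>?M) \<le> (\<integral>s. R s \<partial>?M)"
    proof (rule integral_mono'[OF Ri pw])
      fix s
      have "0 \<le> d / \<delta>\<^sup>2 * g s" using nn d by simp
      then show "0 \<le> R s" using sumnn[of s] by (simp add: R_def)
    qed
    also have "\<dots> = (\<Sum>j\<le>J. 4 / (4 ^ j * d) * ?G (\<rho> j)) + d / \<delta>\<^sup>2 * A"
    proof -
      have i1: "integrable ?M (\<lambda>s. 4 / (4 ^ j * d) * (indicator {t-\<rho> j..t+\<rho> j} s * g s))" for j
        using ind by (rule integrable_mult_right)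
      have i2: "integrable ?M (\<lambda>s. \<Sum>j\<le>J. 4 / (4 ^ j * d) * (indicator {t-\<rho> j..t+\<rho> j} s * g s))"
        using i1 by (rule Bochner_Integration.integrable_sum)
      have i3: "integrable ?M (\<lambda>s. d / \<delta>\<^sup>2 * g s)" using g by (rule integrable_mult_right)
      show ?thesis
        unfolding R_def A_def Bochner_Integration.integral_add[OF i2 i3]
          Bochner_Integration.integral_sum[OF i1] by (simp only: integral_mult_right_zero)
    qed
    also have "(\<Sum>j\<le>J. 4 / (4 ^ j * d) * ?G (\<rho> j)) \<le> (\<Sum>j\<le>J. 4 * e * (1/2) ^ j)"
    proof (rule sum_mono)
      fix j
      have "?G (\<rho> j) \<le> e * (2 ^ j * d)"
        using Gle[OF \<rho>(1,2)[of j]] mult_left_mono[OF \<rho>(3)[of j], of e] e by linarith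
      then have "4 / (4 ^ j * d) * ?G (\<rho> j) \<le> 4 / (4 ^ j * d) * (e * (2 ^ j * d))"
        using d by (intro mult_left_mono) auto
      also have "\<dots> = 4 * e * (1/2) ^ j"
      proof -
        have "(4::real) ^ j = 2 ^ j * 2 ^ j" by (simp add: power_mult_distrib[symmetric])
        then show ?thesis using d by (simp add: field_simps power_divide)
      qed
      finally show "4 / (4 ^ j * d) * ?G (\<rho> j) \<le> 4 * e * (1/2) ^ j" .
    qed
    also have "(\<Sum>j\<le>J. 4 * e * (1/2) ^ j) \<le> 4 * e * 2"
      unfolding sum_distrib_left[symmetric] by (rule mult_left_mono[OF geometric_half_sum_le]) (use e in simp)
    finally show ?thesis by simp
  qed
  have "((\<lambda>d. d / \<delta>\<^sup>2 * A) \<longlongrightarrow> 0 / \<delta>\<^sup>2 * A) (at_right 0)" by (intro tendsto_intros) (use \<delta> in auto)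
  then have "eventually (\<lambda>d. d / \<delta>\<^sup>2 * A < e) (at_right 0)" using e by (intro order_tendstoD(2)) auto
  moreover have "eventually (\<lambda>d. d > (0::real)) (at_right 0)" by (rule eventually_at_right_less)
  ultimately show "eventually (\<lambda>d. dist (\<integral>s. d / (d\<^sup>2 + (s - t)\<^sup>2) * g s \<partial>?M) 0 < e0) (at_right 0)"
  proof eventually_elim
    case (elim d)
    have "0 \<le> (\<integral>s. d / (d\<^sup>2 + (s - t)\<^sup>2) * g s \<partial>?M)"
      using elim nn by (intro Bochner_Integration.integral_nonneg) auto
    moreover have "(\<integral>s. d / (d\<^sup>2 + (s - t)\<^sup>2) * g s \<partial>?M) < 10 * e"
      using key[of d] elim e by linarith
    ultimately show ?case by (simp add: dist_real_def e_def)
  qed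
qed

text \<open>Write f as its deviation from \<open>f t\<close> plus the constant \<open>f t\<close>:
  the deviation is absorbed by the majorant, and the constant is multiplied by the total mass. The
  kernel may change sign and the limit mass L is free, so that the Poisson kernel (L = T) and the
  conjugate error (L = 0) are both instances.\<close>

theorem Lebesgue_point_approximate_identity:
  fixes f :: "real \<Rightarrow> real" and K :: "real \<Rightarrow> real \<Rightarrow> real"
  assumes f: "integrable (lebesgue_on {a<..<b}) f"
    and leb: "((\<lambda>r. (\<integral>s. indicator {t-r..t+r} s * \<bar>f s - f t\<bar> \<partial>lebesgue_on {a<..<b}) / r) \<longlongrightarrow> 0) (at_right 0)"
    and Km: "\<And>d. 0 < d \<Longrightarrow> K d \<in> borel_measurable (lebesgue_on {a<..<b})"
    and \<delta>: "0 < \<delta>"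
    and Kb: "\<And>d s. \<lbrakk>0 < d; d < \<delta>; s \<in> {a<..<b}\<rbrakk> \<Longrightarrow> \<bar>K d s\<bar> \<le> C * (d / (d\<^sup>2 + (s - t)\<^sup>2))"
    and KL: "((\<lambda>d. \<integral>s. K d s \<partial>lebesgue_on {a<..<b}) \<longlongrightarrow> L) (at_right 0)"
  shows "((\<lambda>d. \<integral>s. f s * K d s \<partial>lebesgue_on {a<..<b}) \<longlongrightarrow> L * f t) (at_right 0)"
proof -
  let ?M = "lebesgue_on {a<..<b}"
  interpret finite_measure ?M by (rule finite_measure_lebesgue_on) simp
  have fm [measurable]: "f \<in> borel_measurable ?M" using f by simp
  have id [measurable]: "(\<lambda>s. s) \<in> borel_measurable ?M" using id_borel_measurable_lebesgue_on by (simp add: id_def)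
  define g where "g s = \<bar>f s - f t\<bar>" for s
  have gi: "integrable ?M g" unfolding g_def using f by (intro integrable_abs Bochner_Integration.integrable_diff) auto
  have lim: "((\<lambda>d. \<integral>s. d / (d\<^sup>2 + (s - t)\<^sup>2) * g s \<partial>?M) \<longlongrightarrow> 0) (at_right 0)"
    by (rule integral_Poisson_majorant_tendsto_0[OF gi]) (use leb in \<open>auto simp: g_def\<close>)
  have ker: "\<bar>d / (d\<^sup>2 + (s - t)\<^sup>2)\<bar> \<le> 1 / d" if "0 < d" for d s
  proof -
    have "d / (d\<^sup>2 + (s - t)\<^sup>2) \<le> d / d\<^sup>2" using that by (intro divide_left_mono) (auto simp: add_pos_nonneg)
    also have "\<dots> = 1 / d" by (simp add: power2_eq_square)
    finally show ?thesis using that by simp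
  qed
  have ki: "integrable ?M (\<lambda>s. d / (d\<^sup>2 + (s - t)\<^sup>2) * h s)" if d: "0 < d" and h: "integrable ?M h" for d and h :: "real \<Rightarrow> real"
  proof (rule Bochner_Integration.integrable_bound)
    show "integrable ?M (\<lambda>s. 1 / d * h s)" using h by (rule integrable_mult_right)
    show "AE s in ?M. norm (d / (d\<^sup>2 + (s - t)\<^sup>2) * h s) \<le> norm (1 / d * h s)"
    proof (rule AE_I2)
      fix s
      have "\<bar>d / (d\<^sup>2 + (s - t)\<^sup>2)\<bar> \<le> \<bar>1 / d\<bar>" using ker[OF d, of s] d by simp
      then show "norm (d / (d\<^sup>2 + (s - t)\<^sup>2) * h s) \<le> norm (1 / d * h s)"
        unfolding real_norm_def abs_mult by (rule mult_right_mono) simp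
    qed
    have [measurable]: "h \<in> borel_measurable ?M" using h by simp
    show "(\<lambda>s. d / (d\<^sup>2 + (s - t)\<^sup>2) * h s) \<in> borel_measurable ?M" by measurable
  qed
  have Ki: "integrable ?M (\<lambda>s. h s * K d s)" if d: "0 < d" "d < \<delta>" and h: "integrable ?M h" for d and h :: "real \<Rightarrow> real"
  proof (rule Bochner_Integration.integrable_bound)
    show "integrable ?M (\<lambda>s. C * (d / (d\<^sup>2 + (s - t)\<^sup>2) * h s))" using ki[OF d(1) h] by (rule integrable_mult_right)
    have [measurable]: "h \<in> borel_measurable ?M" "K d \<in> borel_measurable ?M" using h Km d by simp_all
    show "(\<lambda>s. h s * K d s) \<in> borel_measurable ?M" by measurable
    show "AE s in ?M. norm (h s * K d s) \<le> norm (C * (d / (d\<^sup>2 + (s - t)\<^sup>2) * h s))"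
    proof (rule AE_I2)
      fix s assume "s \<in> space ?M"
      then have "\<bar>K d s\<bar> \<le> \<bar>C * (d / (d\<^sup>2 + (s - t)\<^sup>2))\<bar>" using order_trans[OF Kb[OF d, of s] abs_ge_self] by simp
      then have "\<bar>K d s\<bar> * \<bar>h s\<bar> \<le> \<bar>C * (d / (d\<^sup>2 + (s - t)\<^sup>2))\<bar> * \<bar>h s\<bar>" by (rule mult_right_mono) simp
      then show "norm (h s * K d s) \<le> norm (C * (d / (d\<^sup>2 + (s - t)\<^sup>2) * h s))"
        by (simp add: abs_mult mult_ac)
    qed
  qed
  have lim1: "((\<lambda>d. \<integral>s. (f s - f t) * K d s \<partial>?M) \<longlongrightarrow> 0) (at_right 0)"
  proof (rule Lim_null_comparison)
    show "((\<lambda>d. C * (\<integral>s. d / (d\<^sup>2 + (s - t)\<^sup>2) * g s \<partial>?M)) \<longlongrightarrow> 0) (at_right 0)"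
      using tendsto_mult_left[OF lim, of C] by simp
    have "eventually (\<lambda>d. d \<in> {0<..<\<delta>}) (at_right 0)"
      by (rule eventually_at_rightI[of _ \<delta>]) (use \<delta> in auto)
    then show "eventually (\<lambda>d. norm (\<integral>s. (f s - f t) * K d s \<partial>?M) \<le> C * (\<integral>s. d / (d\<^sup>2 + (s - t)\<^sup>2) * g s \<partial>?M)) (at_right 0)"
    proof eventually_elim
      case (elim d)
      have "norm (\<integral>s. (f s - f t) * K d s \<partial>?M) \<le> (\<integral>s. norm ((f s - f t) * K d s) \<partial>?M)"
        by (rule integral_norm_bound)
      also have "\<dots> \<le> (\<integral>s. C * (d / (d\<^sup>2 + (s - t)\<^sup>2) * g s) \<partial>?M)"
      proof (rule integral_mono)
        show "integrable ?M (\<lambda>s. norm ((f s - f t) * K d s))"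
          using f elim by (intro integrable_norm Ki Bochner_Integration.integrable_diff) auto
        show "integrable ?M (\<lambda>s. C * (d / (d\<^sup>2 + (s - t)\<^sup>2) * g s))"
          using ki[of d, OF _ gi] elim by (intro integrable_mult_right) auto
        fix s assume "s \<in> space ?M"
        then have "\<bar>K d s\<bar> \<le> C * (d / (d\<^sup>2 + (s - t)\<^sup>2))" using Kb[of d s] elim by simp
        then have "\<bar>K d s\<bar> * g s \<le> C * (d / (d\<^sup>2 + (s - t)\<^sup>2)) * g s" by (rule mult_right_mono) (simp add: g_def)
        then show "norm ((f s - f t) * K d s) \<le> C * (d / (d\<^sup>2 + (s - t)\<^sup>2) * g s)"
          by (simp add: abs_mult g_def mult_ac)
      qed
      finally show ?case unfolding integral_mult_right_zero .
    qed
  qed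
  have "((\<lambda>d. (\<integral>s. (f s - f t) * K d s \<partial>?M) + (\<integral>s. K d s \<partial>?M) * f t) \<longlongrightarrow> 0 + L * f t) (at_right 0)"
    by (intro tendsto_add lim1 tendsto_mult KL tendsto_const)
  moreover have "eventually (\<lambda>d. (\<integral>s. (f s - f t) * K d s \<partial>?M) + (\<integral>s. K d s \<partial>?M) * f t = (\<integral>s. f s * K d s \<partial>?M)) (at_right 0)"
  proof -
    have "eventually (\<lambda>d. d \<in> {0<..<\<delta>}) (at_right 0)"
      by (rule eventually_at_rightI[of _ \<delta>]) (use \<delta> in auto)
    then show ?thesis
    proof eventually_elim
      case (elim d)
      have "(\<integral>s. f s * K d s \<partial>?M) = (\<integral>s. (f s - f t) * K d s + f t * K d s \<partial>?M)"
        by (simp add: algebra_simps)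
      also have "\<dots> = (\<integral>s. (f s - f t) * K d s \<partial>?M) + (\<integral>s. f t * K d s \<partial>?M)"
        using f elim by (intro Bochner_Integration.integral_add Ki Bochner_Integration.integrable_diff) auto
      finally show ?case by (simp add: mult.commute)
    qed
  qed
  ultimately have "((\<lambda>d. \<integral>s. f s * K d s \<partial>?M) \<longlongrightarrow> 0 + L * f t) (at_right 0)"
    by (rule Lim_transform_eventually)
  then show ?thesis by simp
qed

subsection \<open>Completeness of the space of square integrable functions\<close>

lemma square_integrable_mult:
  fixes f g :: "'a \<Rightarrow> real"
  assumes "f \<in> borel_measurable M" "g \<in> borel_measurable M"
    and "integrable M (\<lambda>x. (f x)\<^sup>2)" "integrable M (\<lambda>x. (g x)\<^sup>2)"
  shows "integrable M (\<lambda>x. f x * g x)"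
proof (rule Bochner_Integration.integrable_bound)
  show "integrable M (\<lambda>x. (f x)\<^sup>2 + (g x)\<^sup>2)" using assms by simp
  show "(\<lambda>x. f x * g x) \<in> borel_measurable M" using assms by simp
  show "AE x in M. norm (f x * g x) \<le> norm ((f x)\<^sup>2 + (g x)\<^sup>2)"
  proof (rule AE_I2)
    fix x
    have "2 * \<bar>f x * g x\<bar> \<le> (f x)\<^sup>2 + (g x)\<^sup>2"
      using zero_le_power2[of "\<bar>f x\<bar> - \<bar>g x\<bar>"] by (simp add: power2_diff abs_mult)
    then show "norm (f x * g x) \<le> norm ((f x)\<^sup>2 + (g x)\<^sup>2)" by simp
  qed
qed

lemma square_integrable_diff:
  fixes f g :: "'a \<Rightarrow> real"
  assumes "f \<in> borel_measurable M" "g \<in> borel_measurable M"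
    and "integrable M (\<lambda>x. (f x)\<^sup>2)" "integrable M (\<lambda>x. (g x)\<^sup>2)"
  shows "integrable M (\<lambda>x. (f x - g x)\<^sup>2)"
proof -
  have "integrable M (\<lambda>x. (f x)\<^sup>2 + (g x)\<^sup>2 - 2 * (f x * g x))"
    using assms square_integrable_mult[OF assms] by simp
  then show ?thesis by (simp add: power2_diff mult.assoc)
qed

text \<open>Cauchy-Schwarz against the constant 1, read off from the nonnegative variance of
  \<bar>f\<bar>. The variance is scaled by the square of the total mass to avoid a division by
  it.\<close>

lemma (in finite_measure) integral_abs_le_sqrt:
  fixes f :: "'a \<Rightarrow> real"
  assumes f [measurable]: "f \<in> borel_measurable M" and f2: "integrable M (\<lambda>x. (f x)\<^sup>2)"
  shows "(\<integral>x. \<bar>f x\<bar> \<partial>M) \<le> sqrt (measure M (space M)) * sqrt (\<integral>x. (f x)\<^sup>2 \<partial>M)"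
proof -
  let ?I = "\<integral>x. \<bar>f x\<bar> \<partial>M" and ?\<mu> = "measure M (space M)"
  have fi: "integrable M (\<lambda>x. \<bar>f x\<bar>)" using square_integrable_imp_integrable[OF f f2] by simp
  have "0 \<le> (\<integral>x. (?\<mu> * \<bar>f x\<bar> - ?I)\<^sup>2 \<partial>M)" by simp
  also have "\<dots> = (\<integral>x. (?\<mu>\<^sup>2 * (f x)\<^sup>2 - 2 * ?\<mu> * ?I * \<bar>f x\<bar>) + ?I\<^sup>2 \<partial>M)"
    by (intro Bochner_Integration.integral_cong) (auto simp: power2_diff power_mult_distrib)
  also have "\<dots> = ?\<mu> * (?\<mu> * (\<integral>x. (f x)\<^sup>2 \<partial>M) - ?I\<^sup>2)"
  proof -
    have i1: "integrable M (\<lambda>x. ?\<mu>\<^sup>2 * (f x)\<^sup>2)" using f2 by (rule integrable_mult_right)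
    have i2: "integrable M (\<lambda>x. 2 * ?\<mu> * ?I * \<bar>f x\<bar>)" using fi by (rule integrable_mult_right)
    show ?thesis
      unfolding Bochner_Integration.integral_add[OF Bochner_Integration.integrable_diff[OF i1 i2] integrable_const]
        Bochner_Integration.integral_diff[OF i1 i2] integral_mult_right_zero lebesgue_integral_const
      by (simp add: power2_eq_square right_diff_distrib)
  qed
  finally have *: "0 \<le> ?\<mu> * (?\<mu> * (\<integral>x. (f x)\<^sup>2 \<partial>M) - ?I\<^sup>2)" .
  show ?thesis
  proof (cases "?\<mu> = 0")
    case True
    then have "AE x in M. False"
      by (auto simp: emeasure_eq_measure AE_iff_measurable[OF _ refl])
    then have "?I = (\<integral>x. 0 \<partial>M)" by (intro integral_cong_AE) auto
    then show ?thesis by simp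
  next
    case False
    then have "?\<mu> > 0" using measure_nonneg[of M "space M"] by linarith
    with * have "?I\<^sup>2 \<le> ?\<mu> * (\<integral>x. (f x)\<^sup>2 \<partial>M)" by (simp add: zero_le_mult_iff)
    then have "sqrt (?I\<^sup>2) \<le> sqrt (?\<mu> * (\<integral>x. (f x)\<^sup>2 \<partial>M))" by (rule real_sqrt_le_mono)
    then show ?thesis by (simp add: real_sqrt_mult)
  qed
qed

text \<open>Riesz-Fischer: a rapidly Cauchy subsequence converges almost everywhere, and Fatou's
  lemma upgrades this to convergence in mean square of the whole sequence.\<close>

theorem (in finite_measure) square_integrable_complete:
  fixes S :: "nat \<Rightarrow> 'a \<Rightarrow> real"
  assumes S [measurable]: "\<And>n. S n \<in> borel_measurable M"
    and S2: "\<And>n. integrable M (\<lambda>x. (S n x)\<^sup>2)"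
    and Cauchy: "\<And>e. 0 < e \<Longrightarrow> \<exists>N. \<forall>m\<ge>N. \<forall>n\<ge>N. (\<integral>x. (S m x - S n x)\<^sup>2 \<partial>M) \<le> e"
  obtains h where "h \<in> borel_measurable M" "integrable M (\<lambda>x. (h x)\<^sup>2)"
    "(\<lambda>n. \<integral>x. (S n x - h x)\<^sup>2 \<partial>M) \<longlonglongrightarrow> 0"
proof -
  have "\<forall>j. \<exists>N. \<forall>m\<ge>N. \<forall>n\<ge>N. (\<integral>x. (S m x - S n x)\<^sup>2 \<partial>M) \<le> (1/4) ^ j"
    using Cauchy by simp
  then obtain N where N: "\<And>j m n. m \<ge> N j \<Longrightarrow> n \<ge> N j \<Longrightarrow> (\<integral>x. (S m x - S n x)\<^sup>2 \<partial>M) \<le> (1/4) ^ j"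
    by metis
  \<comment> \<open>Adding up all \<open>N i\<close> with i \<le> j yields \<open>N j\<close> \<le>
    \<open>r j\<close> and \<open>N j\<close> \<le> \<open>r (Suc j)\<close>, so \<open>N\<close>
    controls the difference of consecutive terms; the summand j makes r unbounded.\<close>
  define r where "r j = j + (\<Sum>i\<le>j. N i)" for j
  have r1: "N j \<le> r j" for j using member_le_sum[of j "{..j}" N] by (simp add: r_def)
  have r2: "N j \<le> r (Suc j)" for j using r1[of j] by (simp add: r_def)
  have rj: "j \<le> r j" for j by (simp add: r_def)
  define d where "d j x = S (r (Suc j)) x - S (r j) x" for j x
  have dm [measurable]: "d j \<in> borel_measurable M" for j unfolding d_def by measurable
  have d2: "integrable M (\<lambda>x. (d j x)\<^sup>2)" for j
    unfolding d_def by (intro square_integrable_diff S S2)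
  let ?\<mu> = "measure M (space M)"
  \<comment> \<open>Finite measure turns the mean-square bound (1/4)^j into an L1 bound proportional
    to (1/2)^j. The absolute differences then have a finite total integral, hence a finite sum
    almost everywhere.\<close>
  have dle: "(\<integral>x. \<bar>d j x\<bar> \<partial>M) \<le> sqrt ?\<mu> * (1/2) ^ j" for j
  proof -
    have "(\<integral>x. (d j x)\<^sup>2 \<partial>M) \<le> (1/4) ^ j" unfolding d_def by (rule N[OF r2 r1])
    also have "(1/4::real) ^ j = ((1/2) ^ j)\<^sup>2" by (simp add: power_mult[symmetric] mult.commute[of j]) (simp add: power_mult power_divide)
    finally have "sqrt (\<integral>x. (d j x)\<^sup>2 \<partial>M) \<le> sqrt (((1/2) ^ j)\<^sup>2)" by (rule real_sqrt_le_mono)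
    then have "sqrt ?\<mu> * sqrt (\<integral>x. (d j x)\<^sup>2 \<partial>M) \<le> sqrt ?\<mu> * (1/2) ^ j" by (intro mult_left_mono) auto
    with integral_abs_le_sqrt[OF dm d2, of j] show ?thesis by linarith
  qed
  have di: "integrable M (\<lambda>x. \<bar>d j x\<bar>)" for j using square_integrable_imp_integrable[OF dm d2] by simp
  have "summable (\<lambda>j. sqrt ?\<mu> * (1/2) ^ j)" by (intro summable_mult summable_geometric) simp
  then have sm: "summable (\<lambda>j. \<integral>x. \<bar>d j x\<bar> \<partial>M)"
    by (rule summable_comparison_test'[where N = 0]) (use dle in simp)
  have "(\<integral>\<^sup>+x. (\<Sum>j. ennreal \<bar>d j x\<bar>) \<partial>M) = (\<Sum>j. ennreal (\<integral>x. \<bar>d j x\<bar> \<partial>M))"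
    by (subst nn_integral_suminf) (auto simp: nn_integral_eq_integral di)
  also have "\<dots> \<noteq> \<infinity>" unfolding infinity_ennreal_def by (rule ennreal_suminf_neq_top[OF sm]) simp
  finally have "AE x in M. (\<Sum>j. ennreal \<bar>d j x\<bar>) \<noteq> \<infinity>"
    by (intro nn_integral_PInf_AE) auto
  then have "AE x in M. summable (\<lambda>j. \<bar>d j x\<bar>)"
    unfolding infinity_ennreal_def by eventually_elim (rule summable_suminf_not_top, simp_all)
  then have lim: "AE x in M. (\<lambda>j. S (r j) x) \<longlonglongrightarrow> lim (\<lambda>j. S (r j) x)"
  proof eventually_elim
    case (elim x)
    then have "summable (\<lambda>j. d j x)" by (rule summable_rabs_cancel)
    then have "convergent (\<lambda>n. \<Sum>j<n. d j x)" by (simp add: summable_iff_convergent)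
    moreover have "(\<Sum>j<n. d j x) = S (r n) x - S (r 0) x" for n
      unfolding d_def by (rule sum_lessThan_telescope)
    ultimately have "convergent (\<lambda>n. S (r n) x)" by (simp add: convergent_diff_const_right_iff)
    then show ?case by (simp add: convergent_LIMSEQ_iff)
  qed
  \<comment> \<open>At points of divergence, which form a null set, \<open>lim\<close> is an
    unspecified value.\<close>
  define h where "h x = lim (\<lambda>j. S (r j) x)" for x
  have h [measurable]: "h \<in> borel_measurable M" unfolding h_def by measurable
  \<comment> \<open>Fatou along the subsequence with n fixed. Integrability belongs to the claim
    because square integrability of h is deduced from it afterwards.\<close>
  have key: "integrable M (\<lambda>x. (S n x - h x)\<^sup>2) \<and> (\<integral>x. (S n x - h x)\<^sup>2 \<partial>M) \<le> e"
    if e: "0 < e" and n: "n \<ge> N0" and N0: "\<forall>m\<ge>N0. \<forall>n\<ge>N0. (\<integral>x. (S m x - S n x)\<^sup>2 \<partial>M) \<le> e" for e n N0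
  proof -
    have "AE x in M. ennreal ((S n x - h x)\<^sup>2) = liminf (\<lambda>j. ennreal ((S n x - S (r j) x)\<^sup>2))"
      using lim
    proof eventually_elim
      case (elim x)
      then have "(\<lambda>j. ennreal ((S n x - S (r j) x)\<^sup>2)) \<longlonglongrightarrow> ennreal ((S n x - h x)\<^sup>2)"
        unfolding h_def by (intro tendsto_ennrealI tendsto_intros)
      from lim_imp_Liminf[OF _ this] show ?case by simp
    qed
    then have "(\<integral>\<^sup>+x. ennreal ((S n x - h x)\<^sup>2) \<partial>M) = (\<integral>\<^sup>+x. liminf (\<lambda>j. ennreal ((S n x - S (r j) x)\<^sup>2)) \<partial>M)"
      by (rule nn_integral_cong_AE)
    also have "\<dots> \<le> liminf (\<lambda>j. \<integral>\<^sup>+x. ennreal ((S n x - S (r j) x)\<^sup>2) \<partial>M)"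
      by (rule nn_integral_liminf) measurable
    also have "\<dots> \<le> ennreal e"
    proof (rule Liminf_le)
      have "eventually (\<lambda>j. j \<ge> N0) sequentially" by (rule eventually_ge_at_top)
      then show "eventually (\<lambda>j. (\<integral>\<^sup>+x. ennreal ((S n x - S (r j) x)\<^sup>2) \<partial>M) \<le> ennreal e) sequentially"
      proof eventually_elim
        case (elim j)
        have "(\<integral>\<^sup>+x. ennreal ((S n x - S (r j) x)\<^sup>2) \<partial>M) = ennreal (\<integral>x. (S n x - S (r j) x)\<^sup>2 \<partial>M)"
          by (intro nn_integral_eq_integral square_integrable_diff S S2) auto
        also have "\<dots> \<le> ennreal e" using N0 n elim rj[of j] by (intro ennreal_leI) auto
        finally show ?case .
      qed
    qed simp
    finally have le: "(\<integral>\<^sup>+x. ennreal ((S n x - h x)\<^sup>2) \<partial>M) \<le> ennreal e" .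
    have i: "integrable M (\<lambda>x. (S n x - h x)\<^sup>2)"
      by (rule integrableI_nonneg) (use le ennreal_less_top[of e] in \<open>auto simp: less_top[symmetric] top_unique\<close>)
    moreover have "ennreal (\<integral>x. (S n x - h x)\<^sup>2 \<partial>M) \<le> ennreal e"
      using le by (subst (asm) nn_integral_eq_integral[OF i]) auto
    ultimately show ?thesis using e by simp
  qed
  have conv: "(\<lambda>n. \<integral>x. (S n x - h x)\<^sup>2 \<partial>M) \<longlonglongrightarrow> 0"
  proof (rule LIMSEQ_I)
    fix e :: real assume "0 < e"
    then obtain N0 where N0: "\<forall>m\<ge>N0. \<forall>n\<ge>N0. (\<integral>x. (S m x - S n x)\<^sup>2 \<partial>M) \<le> e / 2"
      using Cauchy[of "e / 2"] by auto
    have "norm ((\<integral>x. (S n x - h x)\<^sup>2 \<partial>M) - 0) < e" if "n \<ge> N0" for n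
      using key[OF _ that N0] \<open>0 < e\<close> by simp
    then show "\<exists>N0. \<forall>n\<ge>N0. norm ((\<integral>x. (S n x - h x)\<^sup>2 \<partial>M) - 0) < e" by blast
  qed
  obtain N0 where "\<forall>m\<ge>N0. \<forall>n\<ge>N0. (\<integral>x. (S m x - S n x)\<^sup>2 \<partial>M) \<le> 1"
    using Cauchy[of 1] by auto
  then have i0: "integrable M (\<lambda>x. (S N0 x - h x)\<^sup>2)" using key[of 1 N0 N0] by simp
  have "integrable M (\<lambda>x. (S N0 x - (S N0 x - h x))\<^sup>2)"
    by (rule square_integrable_diff[OF _ _ S2 i0]) simp_all
  then have "integrable M (\<lambda>x. (h x)\<^sup>2)" by simp
  then show thesis using that h conv by blast
qed

section \<open>Integrals of continuous functions over a bounded open interval\<close>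

lemma finite_measure_lebesgue_on_Ioo: "finite_measure (lebesgue_on {a<..<b::real})"
  by (rule finite_measure_lebesgue_on) simp

lemma integrable_lebesgue_on_continuous:
  fixes f :: "real \<Rightarrow> real"
  assumes "continuous_on {a..b} f"
  shows "integrable (lebesgue_on {a<..<b}) f"
proof -
  have "f absolutely_integrable_on {a..b}" using assms by (rule absolutely_integrable_continuous_real)
  then have "f absolutely_integrable_on {a<..<b}"
    by (rule set_integrable_subset) auto
  then show ?thesis by (rule absolutely_integrable_imp_integrable) simp
qed

lemma integral_lebesgue_on_FTC:
  fixes f F :: "real \<Rightarrow> real"
  assumes "a \<le> b" and "continuous_on {a..b} f"
    and "\<And>x. x \<in> {a..b} \<Longrightarrow> (F has_field_derivative f x) (at x within {a..b})"
  shows "(\<integral>x. f x \<partial>lebesgue_on {a<..<b}) = F b - F a"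
proof -
  have "(f has_integral (F b - F a)) {a..b}"
    using assms by (intro fundamental_theorem_of_calculus)
      (auto simp: has_real_derivative_iff_has_vector_derivative[symmetric])
  moreover have "(f has_integral (\<integral>x. f x \<partial>lebesgue_on {a<..<b})) {a..b}"
    using has_integral_integral_lebesgue_on[OF integrable_lebesgue_on_continuous[OF assms(2)]]
    by (simp add: has_integral_Icc_iff_Ioo)
  ultimately show ?thesis using has_integral_unique by blast
qed

subsection \<open>The sine and cosine systems on the interval\<close>

locale Hilbert_interval =
  fixes T :: real
  assumes T: "0 < T"
begin

abbreviation M :: "real measure" where "M \<equiv> lebesgue_on {0<..<T}"

abbreviation ang :: "nat \<Rightarrow> real \<Rightarrow> real" where
  "ang k s \<equiv> (pi / 2 + real k * pi) * (s / T)"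

sublocale finite_measure M by (rule finite_measure_lebesgue_on_Ioo)

lemma integral_cos_pi_int:
  "(\<integral>s. cos (pi * of_int m * (s / T)) \<partial>M) = (if m = 0 then T else 0)"
proof (cases "m = 0")
  case True
  then show ?thesis using T by (simp add: measure_restrict_space)
next
  case False
  have "(\<integral>s. cos (pi * of_int m * (s / T)) \<partial>M)
      = sin (pi * of_int m * (T / T)) * T / (pi * of_int m) - sin (pi * of_int m * (0 / T)) * T / (pi * of_int m)"
    using T False by (intro integral_lebesgue_on_FTC) (auto intro!: continuous_intros derivative_eq_intros)
  then show ?thesis using T False by (simp add: sin_npi_int)
qed

text \<open>The frequencies are odd multiples of pi/(2T), so their sums and differences are integer
  multiples of pi/T, for which \<open>integral_cos_pi_int\<close> applies. The integer j + k + 1 is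
  never 0, so only j = k leaves a nonzero integral; integers are used because j - k may be
  negative.\<close>

lemma ang_diff: "ang j s - ang k s = pi * of_int (int j - int k) * (s / T)"
  and ang_add: "ang j s + ang k s = pi * of_int (int j + int k + 1) * (s / T)"
  by (simp_all add: algebra_simps)

lemma integrable_cos_pi: "integrable M (\<lambda>s. cos (c * (s / T)))"
  using T by (intro integrable_lebesgue_on_continuous continuous_intros) auto

lemma sin_orthogonal: "(\<integral>s. sin (ang j s) * sin (ang k s) \<partial>M) = (if j = k then T / 2 else 0)"
proof -
  have "(\<integral>s. sin (ang j s) * sin (ang k s) \<partial>M)
      = (\<integral>s. (cos (pi * of_int (int j - int k) * (s / T)) - cos (pi * of_int (int j + int k + 1) * (s / T))) / 2 \<partial>M)"
    unfolding ang_diff[symmetric] ang_add[symmetric] sin_times_sin ..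
  also have "\<dots> = ((if int j - int k = 0 then T else 0) - (if int j + int k + 1 = 0 then T else 0)) / 2"
    unfolding integral_divide_zero Bochner_Integration.integral_diff[OF integrable_cos_pi integrable_cos_pi]
      integral_cos_pi_int ..
  also have "\<dots> = (if j = k then T / 2 else 0)" by auto
  finally show ?thesis .
qed

lemma cos_orthogonal: "(\<integral>s. cos (ang j s) * cos (ang k s) \<partial>M) = (if j = k then T / 2 else 0)"
proof -
  have "(\<integral>s. cos (ang j s) * cos (ang k s) \<partial>M)
      = (\<integral>s. (cos (pi * of_int (int j - int k) * (s / T)) + cos (pi * of_int (int j + int k + 1) * (s / T))) / 2 \<partial>M)"
    unfolding ang_diff[symmetric] ang_add[symmetric] cos_times_cos ..
  also have "\<dots> = ((if int j - int k = 0 then T else 0) + (if int j + int k + 1 = 0 then T else 0)) / 2"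
    unfolding integral_divide_zero Bochner_Integration.integral_add[OF integrable_cos_pi integrable_cos_pi]
      integral_cos_pi_int ..
  also have "\<dots> = (if j = k then T / 2 else 0)" by auto
  finally show ?thesis .
qed

text \<open>Pythagoras, stated for an abstract system so that the sines and the cosines share one
  expansion of the double sum.\<close>

lemma integral_orthogonal_sum_square:
  fixes e :: "nat \<Rightarrow> real \<Rightarrow> real"
  assumes e: "\<And>k. continuous_on {0..T} (e k)"
    and orth: "\<And>j k. (\<integral>s. e j s * e k s \<partial>M) = (if j = k then T / 2 else 0)"
    and F: "finite F"
  shows "(\<integral>s. (\<Sum>k\<in>F. a k * e k s)\<^sup>2 \<partial>M) = T / 2 * (\<Sum>k\<in>F. (a k)\<^sup>2)"
proof -
  have i: "integrable M (\<lambda>s. a j * a k * (e j s * e k s))" for j k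
    using e by (intro integrable_lebesgue_on_continuous continuous_intros)
  have "(\<integral>s. (\<Sum>k\<in>F. a k * e k s)\<^sup>2 \<partial>M) = (\<integral>s. (\<Sum>j\<in>F. \<Sum>k\<in>F. a j * a k * (e j s * e k s)) \<partial>M)"
    by (simp add: power2_eq_square sum_product mult_ac)
  also have "\<dots> = (\<Sum>j\<in>F. \<Sum>k\<in>F. a j * a k * (\<integral>s. e j s * e k s \<partial>M))"
    unfolding Bochner_Integration.integral_sum[OF Bochner_Integration.integrable_sum[OF i]]
      Bochner_Integration.integral_sum[OF i] integral_mult_right_zero ..
  also have "\<dots> = (\<Sum>j\<in>F. \<Sum>k\<in>F. if j = k then T / 2 * (a j)\<^sup>2 else 0)"
    unfolding orth by (intro sum.cong) (auto simp: power2_eq_square)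
  also have "\<dots> = T / 2 * (\<Sum>k\<in>F. (a k)\<^sup>2)" using F by (simp add: sum_distrib_left)
  finally show ?thesis .
qed

lemma sin_sum_square: "finite F \<Longrightarrow> (\<integral>s. (\<Sum>k\<in>F. a k * sin (ang k s))\<^sup>2 \<partial>M) = T / 2 * (\<Sum>k\<in>F. (a k)\<^sup>2)"
  by (rule integral_orthogonal_sum_square[OF _ sin_orthogonal]) (use T in \<open>auto intro!: continuous_intros\<close>)

lemma cos_sum_square: "finite F \<Longrightarrow> (\<integral>s. (\<Sum>k\<in>F. a k * cos (ang k s))\<^sup>2 \<partial>M) = T / 2 * (\<Sum>k\<in>F. (a k)\<^sup>2)"
  by (rule integral_orthogonal_sum_square[OF _ cos_orthogonal]) (use T in \<open>auto intro!: continuous_intros\<close>)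

section \<open>Bessel's inequality, convergence of the cosine series and its coefficients\<close>

lemma L2D:
  assumes "f \<in> L2_space T"
  shows "f \<in> borel_measurable M" "integrable M (\<lambda>s. (f s)\<^sup>2)" "integrable M f"
proof -
  show *: "f \<in> borel_measurable M" "integrable M (\<lambda>s. (f s)\<^sup>2)"
    using assms unfolding L2_space_def by blast+
  show "integrable M f" by (rule square_integrable_imp_integrable[OF *])
qed

lemma continuous_L2: "continuous_on {0..T} f \<Longrightarrow> f \<in> L2_space T"
  unfolding L2_space_def
  by (intro CollectI conjI borel_measurable_integrable integrable_lebesgue_on_continuous continuous_intros)

lemma L2_mult: "f \<in> L2_space T \<Longrightarrow> g \<in> L2_space T \<Longrightarrow> integrable M (\<lambda>s. f s * g s)"
  by (intro square_integrable_mult) (auto dest: L2D)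

text \<open>Expand the nonnegative integral of the square of \<phi> - P, where P is the partial sine
  sum: the mixed integral of \<phi> and P and the squared norm of P have the same value T/2 times
  the coefficient sum.\<close>

lemma Bessel_sine:
  assumes \<phi>: "\<phi> \<in> L2_space T"
  shows "(\<Sum>k<n. (sine_coeff T \<phi> k)\<^sup>2) \<le> 2 / T * (\<integral>s. (\<phi> s)\<^sup>2 \<partial>M)"
proof -
  define P where "P s = (\<Sum>k<n. sine_coeff T \<phi> k * sin (ang k s))" for s
  have P: "P \<in> L2_space T" unfolding P_def using T by (intro continuous_L2 continuous_intros) auto
  let ?Q = "\<Sum>k<n. (sine_coeff T \<phi> k)\<^sup>2"
  have si: "integrable M (\<lambda>s. \<phi> s * sin (ang k s))" for k
    using T by (intro L2_mult \<phi> continuous_L2 continuous_intros) auto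
  have "(\<integral>s. \<phi> s * P s \<partial>M) = (\<integral>s. (\<Sum>k<n. sine_coeff T \<phi> k * (\<phi> s * sin (ang k s))) \<partial>M)"
    by (simp add: P_def sum_distrib_left mult_ac)
  also have "\<dots> = (\<Sum>k<n. sine_coeff T \<phi> k * (\<integral>s. \<phi> s * sin (ang k s) \<partial>M))"
    by (subst Bochner_Integration.integral_sum) (simp_all only: integrable_mult_right si integral_mult_right_zero)
  also have "\<dots> = (\<Sum>k<n. sine_coeff T \<phi> k * (T / 2 * sine_coeff T \<phi> k))"
    using T by (simp add: sine_coeff_def)
  also have "\<dots> = T / 2 * ?Q" by (simp add: sum_distrib_left power2_eq_square mult_ac)
  finally have c: "(\<integral>s. \<phi> s * P s \<partial>M) = T / 2 * ?Q" .
  have "0 \<le> (\<integral>s. (\<phi> s - P s)\<^sup>2 \<partial>M)" by simp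
  also have "\<dots> = (\<integral>s. (\<phi> s)\<^sup>2 + (P s)\<^sup>2 - 2 * (\<phi> s * P s) \<partial>M)" by (simp add: power2_diff mult.assoc)
  also have "\<dots> = (\<integral>s. (\<phi> s)\<^sup>2 \<partial>M) + (\<integral>s. (P s)\<^sup>2 \<partial>M) - 2 * (\<integral>s. \<phi> s * P s \<partial>M)"
    using L2D(2)[OF \<phi>] L2D(2)[OF P] L2_mult[OF \<phi> P] by simp
  also have "(\<integral>s. (P s)\<^sup>2 \<partial>M) = T / 2 * ?Q" unfolding P_def by (rule sin_sum_square) simp
  finally have "T / 2 * ?Q \<le> (\<integral>s. (\<phi> s)\<^sup>2 \<partial>M)" unfolding c by simp
  then show ?thesis using T by (simp add: field_simps)
qed

text \<open>Orthogonality turns distances of partial sums into tails of the sum of squared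
  coefficients, which Bessel makes small; completeness gives the limit. This is the existence
  statement behind the choice in \<open>modified_Hilbert\<close>.\<close>

lemma cosine_series_converges:
  assumes \<phi>: "\<phi> \<in> L2_space T"
  shows "\<exists>h. L2_sums T (\<lambda>k t. sine_coeff T \<phi> k * cos (ang k t)) h"
proof -
  let ?a = "sine_coeff T \<phi>"
  define S where "S n s = (\<Sum>k<n. ?a k * cos (ang k s))" for n s
  have S: "S n \<in> L2_space T" for n unfolding S_def using T by (intro continuous_L2 continuous_intros) auto
  have sm: "summable (\<lambda>k. (?a k)\<^sup>2)"
    by (rule summableI_nonneg_bounded) (use Bessel_sine[OF \<phi>] in auto)
  have diff: "(\<integral>s. (S m s - S n s)\<^sup>2 \<partial>M) = T / 2 * (\<Sum>k\<in>{n..<m}. (?a k)\<^sup>2)" if "n \<le> m" for m n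
  proof -
    have "S m s - S n s = (\<Sum>k\<in>{n..<m}. ?a k * cos (ang k s))" for s
      unfolding S_def using sum_diff_nat_ivl[of 0 n m "\<lambda>k. ?a k * cos (ang k s)"] that
      by (simp add: atLeast0LessThan)
    then show ?thesis by (simp only: cos_sum_square finite_atLeastLessThan)
  qed
  have "\<exists>N. \<forall>m\<ge>N. \<forall>n\<ge>N. (\<integral>s. (S m s - S n s)\<^sup>2 \<partial>M) \<le> e" if e: "0 < e" for e
  proof -
    have e': "0 < e / T" using e T by simp
    obtain N where N: "\<And>m n. m \<ge> N \<Longrightarrow> norm (\<Sum>k=m..<n. (?a k)\<^sup>2) < e / T"
      using sm[unfolded summable_Cauchy, rule_format, OF e'] by blast
    have le: "(\<integral>s. (S m s - S n s)\<^sup>2 \<partial>M) \<le> e" if "N \<le> n" "n \<le> m" for m n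
    proof -
      have "(\<Sum>k=n..<m. (?a k)\<^sup>2) \<le> e / T" using N[OF that(1), of m] by simp
      then have "T * (\<Sum>k=n..<m. (?a k)\<^sup>2) \<le> e" using T by (simp add: field_simps)
      then show ?thesis using e unfolding diff[OF that(2)] by simp
    qed
    have "(\<integral>s. (S m s - S n s)\<^sup>2 \<partial>M) \<le> e" if "N \<le> n" "N \<le> m" for m n
      using le[of n m] le[of m n] that by (cases "n \<le> m") (auto simp: power2_commute)
    then show ?thesis by blast
  qed
  then obtain h where h: "h \<in> borel_measurable M" "integrable M (\<lambda>x. (h x)\<^sup>2)"
    "(\<lambda>n. \<integral>x. (S n x - h x)\<^sup>2 \<partial>M) \<longlonglongrightarrow> 0"
    using square_integrable_complete[of S] L2D[OF S] by blast
  have "(\<lambda>n. sqrt (\<integral>x. (S n x - h x)\<^sup>2 \<partial>M)) \<longlonglongrightarrow> sqrt 0" using h(3) by (rule tendsto_real_sqrt)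
  moreover have "(\<lambda>t. ?a k * cos (ang k t)) \<in> L2_space T" for k
    using T by (intro continuous_L2 continuous_intros) auto
  ultimately have "L2_sums T (\<lambda>k t. ?a k * cos (ang k t)) h"
    unfolding L2_sums_def L2_norm_def using h by (simp add: S_def L2_space_def)
  then show ?thesis by blast
qed

text \<open>The k-th coefficient of the partial sums is constant once n > k, and mean-square
  convergence lets it pass to the limit because the cosine is bounded by 1.\<close>

lemma L2_sums_cosine_coeff:
  assumes h: "L2_sums T (\<lambda>k t. a k * cos (ang k t)) h"
  shows "(\<integral>s. h s * cos (ang k s) \<partial>M) = T / 2 * a k"
proof -
  define S where "S n s = (\<Sum>k<n. a k * cos (ang k s))" for n s
  have S: "S n \<in> L2_space T" for n unfolding S_def using T by (intro continuous_L2 continuous_intros) auto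
  have hL: "h \<in> L2_space T" and lim: "(\<lambda>n. sqrt (\<integral>s. (S n s - h s)\<^sup>2 \<partial>M)) \<longlonglongrightarrow> 0"
    using h by (auto simp: L2_sums_def L2_norm_def S_def)
  have cL: "(\<lambda>s. cos (ang k s)) \<in> L2_space T" using T by (intro continuous_L2 continuous_intros) auto
  have Sk: "(\<integral>s. S n s * cos (ang k s) \<partial>M) = T / 2 * a k" if "k < n" for n
  proof -
    have i: "integrable M (\<lambda>s. a j * (cos (ang j s) * cos (ang k s)))" for j
      using T by (intro integrable_lebesgue_on_continuous continuous_intros) auto
    have "(\<integral>s. S n s * cos (ang k s) \<partial>M) = (\<integral>s. (\<Sum>j<n. a j * (cos (ang j s) * cos (ang k s))) \<partial>M)"
      unfolding S_def sum_distrib_right mult.assoc ..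
    also have "\<dots> = (\<Sum>j<n. a j * (if j = k then T / 2 else 0))"
      unfolding Bochner_Integration.integral_sum[OF i] integral_mult_right_zero cos_orthogonal ..
    also have "\<dots> = T / 2 * a k" using that by (simp add: if_distrib cong: if_cong)
    finally show ?thesis .
  qed
  have l0: "(\<lambda>n. (\<integral>s. S n s * cos (ang k s) \<partial>M) - (\<integral>s. h s * cos (ang k s) \<partial>M)) \<longlonglongrightarrow> 0"
  proof (rule Lim_null_comparison)
    show "(\<lambda>n. sqrt (measure M (space M)) * sqrt (\<integral>s. (S n s - h s)\<^sup>2 \<partial>M)) \<longlonglongrightarrow> 0"
      using tendsto_mult_left[OF lim, of "sqrt (measure M (space M))"] by simp
    show "eventually (\<lambda>n. norm ((\<integral>s. S n s * cos (ang k s) \<partial>M) - (\<integral>s. h s * cos (ang k s) \<partial>M))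
       \<le> sqrt (measure M (space M)) * sqrt (\<integral>s. (S n s - h s)\<^sup>2 \<partial>M)) sequentially"
    proof (rule always_eventually, rule allI)
      fix n
      have sd: "(\<lambda>s. S n s - h s) \<in> borel_measurable M" "integrable M (\<lambda>s. (S n s - h s)\<^sup>2)"
        using L2D[OF S[of n]] L2D[OF hL] by (auto intro!: square_integrable_diff)
      have eq: "(\<integral>s. S n s * cos (ang k s) \<partial>M) - (\<integral>s. h s * cos (ang k s) \<partial>M) = (\<integral>s. S n s * cos (ang k s) - h s * cos (ang k s) \<partial>M)"
        by (rule Bochner_Integration.integral_diff[symmetric]) (intro L2_mult S hL cL)+
      have "norm ((\<integral>s. S n s * cos (ang k s) \<partial>M) - (\<integral>s. h s * cos (ang k s) \<partial>M))
          \<le> (\<integral>s. norm (S n s * cos (ang k s) - h s * cos (ang k s)) \<partial>M)"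
        unfolding eq by (rule integral_norm_bound)
      also have "\<dots> \<le> (\<integral>s. \<bar>S n s - h s\<bar> \<partial>M)"
      proof (rule integral_mono')
        show "integrable M (\<lambda>s. \<bar>S n s - h s\<bar>)" by (rule integrable_abs[OF square_integrable_imp_integrable[OF sd]])
        fix s
        have "\<bar>S n s - h s\<bar> * \<bar>cos (ang k s)\<bar> \<le> \<bar>S n s - h s\<bar> * 1"
          by (rule mult_left_mono[OF abs_cos_le_one abs_ge_zero])
        then show "norm (S n s * cos (ang k s) - h s * cos (ang k s)) \<le> \<bar>S n s - h s\<bar>"
          by (simp only: left_diff_distrib[symmetric] real_norm_def abs_mult mult_1_right)
      qed simp
      also have "\<dots> \<le> sqrt (measure M (space M)) * sqrt (\<integral>s. (S n s - h s)\<^sup>2 \<partial>M)"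
        by (rule integral_abs_le_sqrt[OF sd])
      finally show "norm ((\<integral>s. S n s * cos (ang k s) \<partial>M) - (\<integral>s. h s * cos (ang k s) \<partial>M))
       \<le> sqrt (measure M (space M)) * sqrt (\<integral>s. (S n s - h s)\<^sup>2 \<partial>M)" .
    qed
  qed
  have "(\<lambda>n. (\<integral>s. S n s * cos (ang k s) \<partial>M) - (\<integral>s. h s * cos (ang k s) \<partial>M))
      \<longlonglongrightarrow> T / 2 * a k - (\<integral>s. h s * cos (ang k s) \<partial>M)"
    by (rule tendsto_eventually) (rule eventually_mono[OF eventually_gt_at_top[of k]], simp only: Sk)
  with l0 have "0 = T / 2 * a k - (\<integral>s. h s * cos (ang k s) \<partial>M)" by (rule LIMSEQ_unique)
  then show ?thesis by simp
qed

end

subsection \<open>Abel means and the Poisson kernels\<close>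

text \<open>Concavity puts the sine above its chord over [0, pi/2].\<close>

lemma sin_Jordan:
  assumes "0 \<le> x" "x \<le> pi / 2"
  shows "2 * x / pi \<le> sin x"
proof -
  have "concave_on {0..pi/2} sin"
    by (rule f''_le0_imp_concave[where f' = cos and f'' = "\<lambda>x. - sin x"])
       (auto intro!: derivative_eq_intros sin_ge_zero)
  then have "sin ((1 - 2 * x / pi) *\<^sub>R 0 + (2 * x / pi) *\<^sub>R (pi / 2)) \<ge> (1 - 2 * x / pi) * sin 0 + (2 * x / pi) * sin (pi / 2)"
    using assms by (intro concave_onD) (auto simp: field_simps)
  then show ?thesis by simp
qed

text \<open>Real and imaginary parts of the geometric series for w/(1 - w^2), where w has modulus
  \<rho> and argument \<alpha>. The form of \<rho> makes (1/\<rho> - \<rho>)/2 equal to \<sigma> and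
  (1/\<rho> + \<rho>)/2 equal to sqrt(1 + \<sigma>^2).\<close>

lemma Abel_trig_sums:
  fixes \<sigma> \<alpha> :: real
  assumes \<sigma>: "0 < \<sigma>"
  defines "\<rho> \<equiv> sqrt (1 + \<sigma>\<^sup>2) - \<sigma>"
  shows "0 < \<rho>" "\<rho> < 1"
    and "(\<lambda>k. \<rho> ^ (2 * k + 1) * cos (real (2 * k + 1) * \<alpha>)) sums (\<sigma> * cos \<alpha> / (2 * (\<sigma>\<^sup>2 + (sin \<alpha>)\<^sup>2)))"
    and "(\<lambda>k. \<rho> ^ (2 * k + 1) * sin (real (2 * k + 1) * \<alpha>)) sums (sqrt (1 + \<sigma>\<^sup>2) * sin \<alpha> / (2 * (\<sigma>\<^sup>2 + (sin \<alpha>)\<^sup>2)))"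
proof -
  define \<kappa> where "\<kappa> = sqrt (1 + \<sigma>\<^sup>2)"
  have k2: "\<kappa>\<^sup>2 = 1 + \<sigma>\<^sup>2" by (simp add: \<kappa>_def)
  have \<rho>: "\<rho> = \<kappa> - \<sigma>" by (simp add: \<rho>_def \<kappa>_def)
  have "sqrt (\<sigma>\<^sup>2) < \<kappa>" unfolding \<kappa>_def by (rule real_sqrt_less_mono) simp
  then show pos: "0 < \<rho>" using \<sigma> by (simp add: \<rho>)
  have "\<kappa>\<^sup>2 < (1 + \<sigma>)\<^sup>2" unfolding k2 using \<sigma> by (simp add: power2_sum)
  then have "\<kappa> < 1 + \<sigma>" by (rule power2_less_imp_less) (use \<sigma> in simp)
  then show less: "\<rho> < 1" by (simp add: \<rho>)
  define w where "w = of_real \<rho> * cis \<alpha>"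
  have nw: "norm w < 1" using pos less by (simp add: w_def norm_mult)
  then have nw2: "norm (w\<^sup>2) < 1" by (simp add: norm_power power_less_one_iff)
  have w0: "w \<noteq> 0" using pos by (simp add: w_def)
  define D where "D = \<sigma>\<^sup>2 + (sin \<alpha>)\<^sup>2"
  have D: "0 < D" using \<sigma> by (simp add: D_def add_pos_nonneg)
  \<comment> \<open>Half the complex conjugate of 1/w - w. Its squared modulus simplifies to D, so
    dividing by 1/w - w amounts to multiplying by z/(2D).\<close>
  define z where "z = Complex (\<sigma> * cos \<alpha>) (\<kappa> * sin \<alpha>)"
  have cs: "(cos \<alpha>)\<^sup>2 = 1 - (sin \<alpha>)\<^sup>2" by (simp add: cos_squared_eq)
  have "1 - w\<^sup>2 = w * (2 * cnj z)"
  proof (rule complex_eqI)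
    have r1: "\<rho> * (\<kappa> + \<sigma>) = 1" using k2 by (simp add: \<rho> algebra_simps power2_eq_square)
    have "Re (w * (2 * cnj z)) = \<rho> * (2 * \<sigma> * (cos \<alpha>)\<^sup>2 + 2 * \<kappa> * (sin \<alpha>)\<^sup>2)"
      by (simp add: w_def z_def power2_eq_square algebra_simps)
    also have "\<dots> = \<rho> * (\<kappa> + \<sigma>) - \<rho>\<^sup>2 * ((cos \<alpha>)\<^sup>2 - (sin \<alpha>)\<^sup>2)"
      unfolding cs by (simp add: \<rho> power2_eq_square algebra_simps)
    finally show "Re (1 - w\<^sup>2) = Re (w * (2 * cnj z))"
      unfolding r1 by (simp add: w_def power2_eq_square algebra_simps)
    show "Im (1 - w\<^sup>2) = Im (w * (2 * cnj z))"
      by (simp add: w_def z_def \<rho> power2_eq_square algebra_simps)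
  qed
  then have "(1 - w\<^sup>2) * z = w * (2 * (z * cnj z))" by (simp add: mult_ac)
  also have "z * cnj z = of_real D"
  proof -
    have "(\<sigma> * cos \<alpha>)\<^sup>2 + (\<kappa> * sin \<alpha>)\<^sup>2 = D"
      unfolding power_mult_distrib k2 cs D_def by (simp add: algebra_simps)
    then show ?thesis by (simp add: complex_mult_cnj z_def)
  qed
  finally have eq: "(1 - w\<^sup>2) * z = w * (2 * of_real D)" .
  have "1 - w\<^sup>2 \<noteq> 0" using nw2 by auto
  then have quot: "w * (1 / (1 - w\<^sup>2)) = z / of_real (2 * D)"
    using eq D by (simp add: field_simps)
  have pw: "w * (w\<^sup>2) ^ k = of_real (\<rho> ^ (2 * k + 1)) * cis (real (2 * k + 1) * \<alpha>)" for k
  proof -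
    have "w * (w\<^sup>2) ^ k = w ^ (2 * k + 1)" by (simp add: power_mult)
    then show ?thesis by (simp only: w_def power_mult_distrib Complex.DeMoivre of_real_power)
  qed
  have "(\<lambda>k. w * (w\<^sup>2) ^ k) sums (w * (1 / (1 - w\<^sup>2)))"
    by (intro sums_mult geometric_sums nw2)
  then have s: "(\<lambda>k. of_real (\<rho> ^ (2 * k + 1)) * cis (real (2 * k + 1) * \<alpha>)) sums (z / of_real (2 * D))"
    unfolding pw quot .
  show "(\<lambda>k. \<rho> ^ (2 * k + 1) * cos (real (2 * k + 1) * \<alpha>)) sums (\<sigma> * cos \<alpha> / (2 * (\<sigma>\<^sup>2 + (sin \<alpha>)\<^sup>2)))"
    using sums_Re[OF s] by (simp add: z_def D_def Re_divide_of_real del: of_real_power of_real_mult power_Suc)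
  show "(\<lambda>k. \<rho> ^ (2 * k + 1) * sin (real (2 * k + 1) * \<alpha>)) sums (sqrt (1 + \<sigma>\<^sup>2) * sin \<alpha> / (2 * (\<sigma>\<^sup>2 + (sin \<alpha>)\<^sup>2)))"
    using sums_Im[OF s] by (simp add: z_def D_def \<kappa>_def Im_divide_of_real del: of_real_power of_real_mult power_Suc)
qed

text \<open>The uniform bounds make the sum of \<open>B k\<close> times \<bar>f\<bar> an integrable
  majorant, which permits termwise integration.\<close>

lemma integral_mult_sums:
  fixes f :: "'a \<Rightarrow> real" and g :: "nat \<Rightarrow> 'a \<Rightarrow> real"
  assumes f: "integrable M f" and gm: "\<And>k. g k \<in> borel_measurable M"
    and gb: "\<And>k x. \<bar>g k x\<bar> \<le> B k" and B: "summable B" and G: "\<And>x. (\<lambda>k. g k x) sums G x"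
  shows "(\<lambda>k. \<integral>x. f x * g k x \<partial>M) sums (\<integral>x. f x * G x \<partial>M)"
proof -
  have B0: "0 \<le> B k" for k using gb[of k undefined] by linarith
  have le: "norm (f x * g k x) \<le> B k * \<bar>f x\<bar>" for k x
  proof -
    have "\<bar>g k x\<bar> * \<bar>f x\<bar> \<le> B k * \<bar>f x\<bar>" by (rule mult_right_mono[OF gb]) simp
    then show ?thesis by (simp add: abs_mult mult.commute)
  qed
  have iB: "integrable M (\<lambda>x. B k * \<bar>f x\<bar>)" for k using f by simp
  have i: "integrable M (\<lambda>x. f x * g k x)" for k
  proof (rule Bochner_Integration.integrable_bound[OF iB[of k]])
    show "(\<lambda>x. f x * g k x) \<in> borel_measurable M" using f gm[of k] by simp
    show "AE x in M. norm (f x * g k x) \<le> norm (B k * \<bar>f x\<bar>)"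
      using le[of _ k] by (intro AE_I2) (metis abs_ge_self order_trans real_norm_def)
  qed
  have "(\<lambda>k. \<integral>x. f x * g k x \<partial>M) sums (\<integral>x. (\<Sum>k. f x * g k x) \<partial>M)"
  proof (rule sums_integral[OF i])
    show "AE x in M. summable (\<lambda>k. norm (f x * g k x))"
      by (intro AE_I2 summable_comparison_test'[OF summable_mult2[OF B], where N = 0]) (use le in simp)
    show "summable (\<lambda>k. \<integral>x. norm (f x * g k x) \<partial>M)"
    proof (rule summable_comparison_test'[OF summable_mult2[OF B], where N = 0])
      fix k
      have "(\<integral>x. norm (f x * g k x) \<partial>M) \<le> (\<integral>x. B k * \<bar>f x\<bar> \<partial>M)"
        by (rule integral_mono[OF integrable_norm[OF i] iB le])
      then show "norm (\<integral>x. norm (f x * g k x) \<partial>M) \<le> B k * (\<integral>x. \<bar>f x\<bar> \<partial>M)" by simp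
    qed
  qed
  moreover have "(\<Sum>k. f x * g k x) = f x * G x" for x
    using sums_mult[OF G] by (rule sums_unique[symmetric])
  ultimately show ?thesis by simp
qed

context Hilbert_interval
begin

abbreviation ha :: "real \<Rightarrow> real" where "ha u \<equiv> pi * (u / (2 * T))"

text \<open>The Poisson kernel of the odd-frequency system, that is, the sum of \<rho>^(2k+1)
  cos((2k+1) \<open>ha u\<close>) in closed form; \<open>qker\<close> is the conjugate kernel, with
  sines. As \<sigma> tends to 0, \<rho> tends to 1 and \<open>qker\<close> tends to 1/(2
  sin(\<open>ha u\<close>)) wherever that sine is nonzero.\<close>

definition pker :: "real \<Rightarrow> real \<Rightarrow> real" where
  "pker \<sigma> u = \<sigma> * cos (ha u) / (2 * (\<sigma>\<^sup>2 + (sin (ha u))\<^sup>2))"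

definition qker :: "real \<Rightarrow> real \<Rightarrow> real" where
  "qker \<sigma> u = sqrt (1 + \<sigma>\<^sup>2) * sin (ha u) / (2 * (\<sigma>\<^sup>2 + (sin (ha u))\<^sup>2))"

lemma ang_ha: "ang k u = real (2 * k + 1) * ha u"
  using T by (simp add: field_simps)

text \<open>Twice a product of trigonometric functions at s and t is a sum of values at s - t and s
  + t; this is where the reflected argument s + t enters. Both series carry the cosine at t, since
  the Hilbert transform replaces only the sine at t.\<close>

lemma Abel_kernel_integrals:
  assumes f: "integrable M f" and \<sigma>: "0 < \<sigma>"
  defines "\<rho> \<equiv> sqrt (1 + \<sigma>\<^sup>2) - \<sigma>"
  shows "(\<lambda>k. 2 * \<rho> ^ (2 * k + 1) * cos (ang k t) * (\<integral>s. f s * cos (ang k s) \<partial>M))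
      sums (\<integral>s. f s * (pker \<sigma> (s - t) + pker \<sigma> (s + t)) \<partial>M)"
    and "(\<lambda>k. 2 * \<rho> ^ (2 * k + 1) * cos (ang k t) * (\<integral>s. f s * sin (ang k s) \<partial>M))
      sums (\<integral>s. f s * (qker \<sigma> (s - t) + qker \<sigma> (s + t)) \<partial>M)"
proof -
  note A = Abel_trig_sums[OF \<sigma>, folded \<rho>_def]
  have B: "summable (\<lambda>k. 2 * \<rho> ^ (2 * k + 1))"
  proof -
    have "norm (\<rho>\<^sup>2) < 1" using A(1,2) by (simp add: power_less_one_iff)
    then have "summable (\<lambda>k. 2 * \<rho> * (\<rho>\<^sup>2) ^ k)" by (intro summable_mult summable_geometric)
    moreover have "2 * \<rho> * (\<rho>\<^sup>2) ^ k = 2 * \<rho> ^ (2 * k + 1)" for k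
      by (simp only: power_mult power_add power_one_right) simp
    ultimately show ?thesis by (simp only:)
  qed
  have bound: "\<bar>2 * \<rho> ^ (2 * k + 1) * (x * y)\<bar> \<le> 2 * \<rho> ^ (2 * k + 1)" if "\<bar>x\<bar> \<le> 1" "\<bar>y\<bar> \<le> 1" for k x y
  proof -
    have "\<bar>x\<bar> * \<bar>y\<bar> \<le> 1 * 1" using that by (intro mult_mono) auto
    then have "2 * \<rho> ^ (2 * k + 1) * \<bar>x * y\<bar> \<le> 2 * \<rho> ^ (2 * k + 1) * 1"
      using A(1) by (intro mult_left_mono) (auto simp: abs_mult)
    then show ?thesis using A(1) by (simp add: abs_mult)
  qed
  have cm: "(\<lambda>s. 2 * \<rho> ^ (2 * k + 1) * (cos (ang k s) * cos (ang k t))) \<in> borel_measurable M" for k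
    using T by (intro borel_measurable_integrable integrable_lebesgue_on_continuous continuous_intros) auto
  have sm: "(\<lambda>s. 2 * \<rho> ^ (2 * k + 1) * (sin (ang k s) * cos (ang k t))) \<in> borel_measurable M" for k
    using T by (intro borel_measurable_integrable integrable_lebesgue_on_continuous continuous_intros) auto
  have ad: "ang k (s - t) = ang k s - ang k t" "ang k (s + t) = ang k s + ang k t" for k s
    by (simp_all add: diff_divide_distrib add_divide_distrib algebra_simps)
  have cs: "(\<lambda>k. 2 * \<rho> ^ (2 * k + 1) * (cos (ang k s) * cos (ang k t))) sums (pker \<sigma> (s - t) + pker \<sigma> (s + t))" for s
  proof -
    have "(\<lambda>k. \<rho> ^ (2 * k + 1) * cos (ang k (s - t)) + \<rho> ^ (2 * k + 1) * cos (ang k (s + t))) sums (pker \<sigma> (s - t) + pker \<sigma> (s + t))"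
      unfolding ang_ha pker_def by (intro sums_add A(3))
    moreover have "\<rho> ^ (2 * k + 1) * cos (ang k (s - t)) + \<rho> ^ (2 * k + 1) * cos (ang k (s + t)) = 2 * \<rho> ^ (2 * k + 1) * (cos (ang k s) * cos (ang k t))" for k
      unfolding ad cos_times_cos by (simp add: distrib_left)
    ultimately show ?thesis by simp
  qed
  have ss: "(\<lambda>k. 2 * \<rho> ^ (2 * k + 1) * (sin (ang k s) * cos (ang k t))) sums (qker \<sigma> (s - t) + qker \<sigma> (s + t))" for s
  proof -
    have "(\<lambda>k. \<rho> ^ (2 * k + 1) * sin (ang k (s - t)) + \<rho> ^ (2 * k + 1) * sin (ang k (s + t))) sums (qker \<sigma> (s - t) + qker \<sigma> (s + t))"
      unfolding ang_ha qker_def by (intro sums_add A(4))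
    moreover have "\<rho> ^ (2 * k + 1) * sin (ang k (s - t)) + \<rho> ^ (2 * k + 1) * sin (ang k (s + t)) = 2 * \<rho> ^ (2 * k + 1) * (sin (ang k s) * cos (ang k t))" for k
      unfolding ad sin_times_cos by (simp add: distrib_left)
    ultimately show ?thesis by simp
  qed
  have "(\<lambda>k. \<integral>s. f s * (2 * \<rho> ^ (2 * k + 1) * (cos (ang k s) * cos (ang k t))) \<partial>M) sums (\<integral>s. f s * (pker \<sigma> (s - t) + pker \<sigma> (s + t)) \<partial>M)"
    by (rule integral_mult_sums[OF f cm bound B cs]) (rule abs_cos_le_one)+
  moreover have "(\<integral>s. f s * (2 * \<rho> ^ (2 * k + 1) * (cos (ang k s) * cos (ang k t))) \<partial>M) = 2 * \<rho> ^ (2 * k + 1) * cos (ang k t) * (\<integral>s. f s * cos (ang k s) \<partial>M)" for k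
    unfolding integral_mult_right_zero[symmetric] by (simp only: mult_ac)
  ultimately show "(\<lambda>k. 2 * \<rho> ^ (2 * k + 1) * cos (ang k t) * (\<integral>s. f s * cos (ang k s) \<partial>M))
      sums (\<integral>s. f s * (pker \<sigma> (s - t) + pker \<sigma> (s + t)) \<partial>M)" by (simp only:)
  have "(\<lambda>k. \<integral>s. f s * (2 * \<rho> ^ (2 * k + 1) * (sin (ang k s) * cos (ang k t))) \<partial>M) sums (\<integral>s. f s * (qker \<sigma> (s - t) + qker \<sigma> (s + t)) \<partial>M)"
    by (rule integral_mult_sums[OF f sm bound B ss]) (rule abs_sin_le_one abs_cos_le_one)+
  moreover have "(\<integral>s. f s * (2 * \<rho> ^ (2 * k + 1) * (sin (ang k s) * cos (ang k t))) \<partial>M) = 2 * \<rho> ^ (2 * k + 1) * cos (ang k t) * (\<integral>s. f s * sin (ang k s) \<partial>M)" for k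
    unfolding integral_mult_right_zero[symmetric] by (simp only: mult_ac)
  ultimately show "(\<lambda>k. 2 * \<rho> ^ (2 * k + 1) * cos (ang k t) * (\<integral>s. f s * sin (ang k s) \<partial>M))
      sums (\<integral>s. f s * (qker \<sigma> (s - t) + qker \<sigma> (s + t)) \<partial>M)" by (simp only:)
qed

text \<open>The Abel means of the cosine series, written once as a Poisson integral of its sum \<open>h\<close> and once
  as a conjugate Poisson integral of \<open>\<phi>\<close>.\<close>

lemma Poisson_eq_conjugate_Poisson:
  assumes \<phi>: "\<phi> \<in> L2_space T" and \<sigma>: "0 < \<sigma>"
    and h: "L2_sums T (\<lambda>k t. sine_coeff T \<phi> k * cos (ang k t)) h"
  shows "(\<integral>s. h s * (pker \<sigma> (s - t) + pker \<sigma> (s + t)) \<partial>M) = (\<integral>s. \<phi> s * (qker \<sigma> (s - t) + qker \<sigma> (s + t)) \<partial>M)"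
proof -
  have "h \<in> L2_space T" using h by (simp add: L2_sums_def)
  then have hi: "integrable M h" by (rule L2D)
  have "(\<integral>s. h s * cos (ang k s) \<partial>M) = (\<integral>s. \<phi> s * sin (ang k s) \<partial>M)" for k
    using T unfolding L2_sums_cosine_coeff[OF h] by (simp add: sine_coeff_def)
  then show ?thesis
    using Abel_kernel_integrals(1)[OF hi \<sigma>, of t] Abel_kernel_integrals(2)[OF L2D(3)[OF \<phi>] \<sigma>, of t]
    by (simp only: sums_unique2)
qed

end

subsection \<open>Kernel estimates\<close>

text \<open>Over a common denominator the numerator is (sqrt(1 + \<sigma>^2) - 1) x^2 - \<sigma>^2,
  a difference of two numbers in [0, \<sigma>^2], because the bracket is at most \<sigma>^2 and x^2
  \<le> 1.\<close>

lemma conjugate_kernel_error: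
  fixes \<sigma> x :: real
  assumes "0 < \<sigma>" "x \<noteq> 0" "\<bar>x\<bar> \<le> 1"
  shows "\<bar>sqrt (1 + \<sigma>\<^sup>2) * x / (2 * (\<sigma>\<^sup>2 + x\<^sup>2)) - 1 / (2 * x)\<bar> \<le> \<sigma>\<^sup>2 / (2 * \<bar>x\<bar> * (\<sigma>\<^sup>2 + x\<^sup>2))"
proof -
  define \<kappa> where "\<kappa> = sqrt (1 + \<sigma>\<^sup>2)"
  have k1: "1 \<le> \<kappa>" by (simp add: \<kappa>_def)
  have "\<kappa> \<le> \<kappa>\<^sup>2" using k1 by (simp add: power2_eq_square)
  then have k2: "\<kappa> - 1 \<le> \<sigma>\<^sup>2" by (simp add: \<kappa>_def)
  have x2: "x\<^sup>2 \<le> 1" using assms(3) by (simp add: abs_square_le_1)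
  have "(\<kappa> - 1) * x\<^sup>2 \<le> \<sigma>\<^sup>2 * 1" using k1 k2 x2 by (intro mult_mono) auto
  moreover have "0 \<le> (\<kappa> - 1) * x\<^sup>2" using k1 by simp
  ultimately have num: "\<bar>(\<kappa> - 1) * x\<^sup>2 - \<sigma>\<^sup>2\<bar> \<le> \<sigma>\<^sup>2" by (auto simp: abs_le_iff)
  have D: "0 < \<sigma>\<^sup>2 + x\<^sup>2" using assms(1) by (simp add: add_pos_nonneg)
  have "\<kappa> * x / (2 * (\<sigma>\<^sup>2 + x\<^sup>2)) - 1 / (2 * x) = ((\<kappa> - 1) * x\<^sup>2 - \<sigma>\<^sup>2) / (2 * x * (\<sigma>\<^sup>2 + x\<^sup>2))"
    using assms(2) D by (simp add: divide_simps) (simp add: algebra_simps power2_eq_square)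
  then have "\<bar>\<kappa> * x / (2 * (\<sigma>\<^sup>2 + x\<^sup>2)) - 1 / (2 * x)\<bar> = \<bar>(\<kappa> - 1) * x\<^sup>2 - \<sigma>\<^sup>2\<bar> / (2 * \<bar>x\<bar> * (\<sigma>\<^sup>2 + x\<^sup>2))"
    using D by (simp add: abs_mult)
  also have "\<dots> \<le> \<sigma>\<^sup>2 / (2 * \<bar>x\<bar> * (\<sigma>\<^sup>2 + x\<^sup>2))"
    using num D by (intro divide_right_mono) auto
  finally show ?thesis by (simp add: \<kappa>_def)
qed

context Hilbert_interval
begin

lemma sin_ha_ge: "\<bar>u\<bar> \<le> T \<Longrightarrow> \<bar>u\<bar> / T \<le> \<bar>sin (ha u)\<bar>"
proof -
  assume u: "\<bar>u\<bar> \<le> T"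
  have "ha \<bar>u\<bar> \<le> pi * (1 / 2)" using u T by (intro mult_left_mono) (auto simp: field_simps)
  then have "2 * ha \<bar>u\<bar> / pi \<le> sin (ha \<bar>u\<bar>)" using T by (intro sin_Jordan) auto
  also have "sin (ha \<bar>u\<bar>) \<le> \<bar>sin (ha u)\<bar>" by (cases "0 \<le> u") auto
  finally show ?thesis using T by simp
qed

lemma ha_less: "0 < s \<Longrightarrow> s < T \<Longrightarrow> 0 < ha s \<and> ha s < pi / 2"
  using T by (simp add: field_simps)

lemma sin_cos_ha_pos:
  assumes "s \<in> {0<..<T}"
  shows "0 < sin (ha s)" "0 < cos (ha s)"
  using sin_gt_zero2[of "ha s"] cos_gt_zero[of "ha s"] ha_less[of s] assms by simp_all

lemma ha_add: "ha (s + t) = ha s + ha t" and ha_diff: "ha (s - t) = ha s - ha t"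
  by (simp_all add: add_divide_distrib diff_divide_distrib algebra_simps)

text \<open>The sum and the difference of the two sines are twice products of positive sines and
  cosines. It lets the term in s + t share the majorant centred at s = t.\<close>

lemma sin_ha_diff_le:
  assumes "s \<in> {0<..<T}" "t \<in> {0<..<T}"
  shows "\<bar>sin (ha (s - t))\<bar> \<le> sin (ha (s + t))"
proof -
  have "0 < sin (ha s)" "0 < cos (ha s)" "0 < sin (ha t)" "0 < cos (ha t)"
    using sin_cos_ha_pos[OF assms(1)] sin_cos_ha_pos[OF assms(2)] .
  then have "0 < sin (ha s) * cos (ha t)" "0 < cos (ha s) * sin (ha t)" by simp_all
  then show ?thesis unfolding ha_add ha_diff sin_add sin_diff by linarith
qed

text \<open>In the first quadrant sine plus cosine is at least 1. The bound is uniform in s, so the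
  reflected term stays regular for each fixed t.\<close>

lemma sin_ha_add_ge:
  assumes "s \<in> {0<..<T}" "t \<in> {0<..<T}"
  shows "min (sin (ha t)) (cos (ha t)) \<le> sin (ha (s + t))"
proof -
  have p: "0 < sin (ha s)" "0 < cos (ha s)" "0 < sin (ha t)" "0 < cos (ha t)"
    using sin_cos_ha_pos[OF assms(1)] sin_cos_ha_pos[OF assms(2)] .
  let ?m = "min (sin (ha t)) (cos (ha t))"
  have "(sin (ha s))\<^sup>2 \<le> sin (ha s)" "(cos (ha s))\<^sup>2 \<le> cos (ha s)"
    using p by (auto simp: power2_eq_square mult_left_le)
  then have "1 \<le> sin (ha s) + cos (ha s)" using sin_cos_squared_add[of "ha s"] by linarith
  then have "?m * 1 \<le> ?m * (sin (ha s) + cos (ha s))" using p by (intro mult_left_mono) auto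
  also have "\<dots> \<le> sin (ha s) * cos (ha t) + cos (ha s) * sin (ha t)"
    unfolding distrib_left using p by (intro add_mono) (auto simp: mult.commute intro: mult_right_mono)
  finally show ?thesis unfolding ha_add sin_add by simp
qed

text \<open>With \<sigma> = d/T both summands of the denominator are at least their counterparts in
  d^2 + u^2 divided by T^2, which leaves the factor T.\<close>

lemma kernel_denominator:
  assumes "0 < d" "\<bar>u\<bar> / T \<le> \<bar>sin (ha v)\<bar>"
  shows "(d / T) / ((d / T)\<^sup>2 + (sin (ha v))\<^sup>2) \<le> T * (d / (d\<^sup>2 + u\<^sup>2))"
proof -
  have "(\<bar>u\<bar> / T)\<^sup>2 \<le> (sin (ha v))\<^sup>2" using assms T by (intro abs_le_square_iff[THEN iffD1]) simp
  then have le: "(d\<^sup>2 + u\<^sup>2) / T\<^sup>2 \<le> (d / T)\<^sup>2 + (sin (ha v))\<^sup>2"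
    by (simp add: power_divide add_divide_distrib)
  have pos: "0 < (d\<^sup>2 + u\<^sup>2) / T\<^sup>2" using assms T by (simp add: add_pos_nonneg)
  have "(d / T) / ((d / T)\<^sup>2 + (sin (ha v))\<^sup>2) \<le> (d / T) / ((d\<^sup>2 + u\<^sup>2) / T\<^sup>2)"
    using le pos assms T by (intro divide_left_mono mult_pos_pos) auto
  also have "\<dots> = T * (d / (d\<^sup>2 + u\<^sup>2))" using T by (simp add: power2_eq_square)
  finally show ?thesis .
qed

lemma pker_bound:
  assumes d: "0 < d" and v: "\<bar>u\<bar> / T \<le> \<bar>sin (ha v)\<bar>"
  shows "\<bar>pker (d / T) v\<bar> \<le> T / 2 * (d / (d\<^sup>2 + u\<^sup>2))"
proof -
  let ?\<sigma> = "d / T" and ?D = "(d / T)\<^sup>2 + (sin (ha v))\<^sup>2"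
  have D: "0 < ?D" using d T by (simp add: add_pos_nonneg)
  have "\<bar>pker ?\<sigma> v\<bar> = ?\<sigma> * \<bar>cos (ha v)\<bar> / (2 * ?D)"
    using d T D by (simp add: pker_def abs_mult)
  also have "\<dots> \<le> ?\<sigma> * 1 / (2 * ?D)"
    using d T D by (intro divide_right_mono mult_left_mono) auto
  also have "\<dots> = (?\<sigma> / ?D) / 2" by simp
  also have "\<dots> \<le> (T * (d / (d\<^sup>2 + u\<^sup>2))) / 2"
    by (rule divide_right_mono[OF kernel_denominator[OF d v]]) simp
  also have "\<dots> = T / 2 * (d / (d\<^sup>2 + u\<^sup>2))" by (rule times_divide_eq_left[symmetric])
  finally show ?thesis .
qed

text \<open>Here \<open>u\<close> is the distance to the singularity, which decides the truncation, and \<open>v\<close> the argument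
  of the kernel; \<open>v = u\<close> for the singular term and \<open>v = s + t\<close>, \<open>u = s - t\<close> for the regular one.\<close>

definition err :: "real \<Rightarrow> real \<Rightarrow> real \<Rightarrow> real" where
  "err d u v = qker (d / T) v - (if d < \<bar>u\<bar> then 1 / (2 * sin (ha v)) else 0)"

lemma sqrt_le_2: "0 < d \<Longrightarrow> d < T \<Longrightarrow> sqrt (1 + (d / T)\<^sup>2) \<le> 2"
proof -
  assume "0 < d" "d < T"
  then have "(d / T)\<^sup>2 \<le> 1" by (simp add: abs_square_le_1)
  then show ?thesis by (intro real_le_lsqrt) auto
qed

text \<open>Beyond the cut-off, \<open>conjugate_kernel_error\<close> applies with the sine
  exceeding \<sigma> in absolute value. Within it nothing is subtracted, and the
  arithmetic-geometric mean inequality bounds the kernel by 1/(2\<sigma>), which is the value of the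
  majorant at distance d.\<close>

lemma err_bound:
  assumes d: "0 < d" "d < T" and v: "\<bar>u\<bar> / T \<le> \<bar>sin (ha v)\<bar>"
  shows "\<bar>err d u v\<bar> \<le> T * (d / (d\<^sup>2 + u\<^sup>2))"
proof -
  define x where "x = sin (ha v)"
  define \<sigma> where "\<sigma> = d / T"
  have \<sigma>: "0 < \<sigma>" using d T by (simp add: \<sigma>_def)
  have D: "0 < \<sigma>\<^sup>2 + x\<^sup>2" using \<sigma> by (simp add: add_pos_nonneg)
  have x1: "\<bar>x\<bar> \<le> 1" by (simp add: x_def)
  show ?thesis
  proof (cases "d < \<bar>u\<bar>")
    case True
    then have "\<sigma> < \<bar>u\<bar> / T" using T by (simp add: \<sigma>_def divide_strict_right_mono)
    then have x: "\<sigma> < \<bar>x\<bar>" using v by (simp add: x_def)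
    have "\<bar>err d u v\<bar> \<le> \<sigma>\<^sup>2 / (2 * \<bar>x\<bar> * (\<sigma>\<^sup>2 + x\<^sup>2))"
      using conjugate_kernel_error[OF \<sigma> _ x1] x \<sigma> True by (simp add: err_def qker_def x_def \<sigma>_def)
    also have "\<dots> \<le> \<sigma>\<^sup>2 / (\<sigma> * (\<sigma>\<^sup>2 + x\<^sup>2))"
      using x \<sigma> D by (intro divide_left_mono mult_right_mono mult_pos_pos) auto
    also have "\<dots> = \<sigma> / (\<sigma>\<^sup>2 + x\<^sup>2)" by (simp add: power2_eq_square)
    also have "\<dots> \<le> T * (d / (d\<^sup>2 + u\<^sup>2))"
      unfolding \<sigma>_def x_def by (rule kernel_denominator[OF d(1) v])
    finally show ?thesis .
  next
    case False
    have "0 \<le> (\<sigma> - \<bar>x\<bar>)\<^sup>2" by simp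
    then have am: "2 * \<sigma> * \<bar>x\<bar> \<le> \<sigma>\<^sup>2 + x\<^sup>2" by (simp add: power2_diff)
    have "\<bar>err d u v\<bar> = sqrt (1 + \<sigma>\<^sup>2) * \<bar>x\<bar> / (2 * (\<sigma>\<^sup>2 + x\<^sup>2))"
      using False D by (simp add: err_def qker_def x_def \<sigma>_def abs_mult)
    also have "\<dots> \<le> 2 * \<bar>x\<bar> / (2 * (\<sigma>\<^sup>2 + x\<^sup>2))"
      using sqrt_le_2[OF d] D by (intro divide_right_mono mult_right_mono) (auto simp: \<sigma>_def)
    also have "\<dots> = (2 * \<sigma> * \<bar>x\<bar>) / (\<sigma>\<^sup>2 + x\<^sup>2) / (2 * \<sigma>)" using \<sigma> by (simp del: distrib_left_numeral)
    also have "\<dots> \<le> 1 / (2 * \<sigma>)"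
      using am D \<sigma> by (intro divide_right_mono) auto
    also have "\<dots> = T * (d / (d\<^sup>2 + d\<^sup>2))" using d T by (simp add: \<sigma>_def power2_eq_square)
    also have "\<dots> \<le> T * (d / (d\<^sup>2 + u\<^sup>2))"
    proof -
      have "u\<^sup>2 \<le> d\<^sup>2" using False d by (intro abs_le_square_iff[THEN iffD1]) auto
      then show ?thesis using d T by (intro mult_left_mono divide_left_mono mult_pos_pos add_left_mono) (auto simp: add_pos_nonneg)
    qed
    finally show ?thesis .
  qed
qed

text \<open>A better estimate for the reflected term: O(d^2) beyond the cut-off and bounded on a
  window of length 2d, so its integral is O(d), whereas \<open>err_bound\<close> only gives a
  bounded integral.\<close>

lemma err_bound_away:
  assumes d: "0 < d" "d < T" and m: "0 < m" "m \<le> sin (ha v)"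
  shows "\<bar>err d (s - t) v\<bar> \<le> d\<^sup>2 / (2 * m ^ 3 * T\<^sup>2) + 1 / m * indicator {t-d..t+d} s"
proof -
  define x where "x = sin (ha v)"
  define \<sigma> where "\<sigma> = d / T"
  have \<sigma>: "0 < \<sigma>" using d T by (simp add: \<sigma>_def)
  have x: "0 < x" "m \<le> x" "\<bar>x\<bar> \<le> 1" using m by (auto simp: x_def)
  have D: "0 < \<sigma>\<^sup>2 + x\<^sup>2" using \<sigma> by (simp add: add_pos_nonneg)
  have m2: "m\<^sup>2 \<le> x\<^sup>2" using x m by (intro power_mono) auto
  show ?thesis
  proof (cases "d < \<bar>s - t\<bar>")
    case True
    then have ni: "s \<notin> {t-d..t+d}" by auto
    have "\<bar>err d (s - t) v\<bar> \<le> \<sigma>\<^sup>2 / (2 * \<bar>x\<bar> * (\<sigma>\<^sup>2 + x\<^sup>2))"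
      using conjugate_kernel_error[OF \<sigma> _ x(3)] x \<sigma> True by (simp add: err_def qker_def x_def \<sigma>_def)
    also have "\<dots> \<le> \<sigma>\<^sup>2 / (2 * m * m\<^sup>2)"
      using x m m2 D by (intro divide_left_mono mult_mono mult_pos_pos) (auto intro: add_increasing)
    also have "\<dots> = d\<^sup>2 / (2 * m ^ 3 * T\<^sup>2)" by (simp add: \<sigma>_def power_divide power3_eq_cube power2_eq_square)
    finally show ?thesis using ni by simp
  next
    case False
    then have i: "s \<in> {t-d..t+d}" by auto
    have e: "err d (s - t) v = sqrt (1 + \<sigma>\<^sup>2) * x / (2 * (\<sigma>\<^sup>2 + x\<^sup>2))"
      using False by (simp only: err_def qker_def x_def \<sigma>_def if_False diff_0_right)
    have "\<bar>err d (s - t) v\<bar> = sqrt (1 + \<sigma>\<^sup>2) * x / (2 * (\<sigma>\<^sup>2 + x\<^sup>2))"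
      unfolding e by (rule abs_of_nonneg) (use D x in simp)
    also have "\<dots> \<le> 2 * x / (2 * (\<sigma>\<^sup>2 + x\<^sup>2))"
      using sqrt_le_2[OF d] D x by (intro divide_right_mono mult_right_mono) (auto simp: \<sigma>_def)
    also have "\<dots> \<le> 2 * x / (2 * x\<^sup>2)"
      using x D by (intro divide_left_mono mult_pos_pos) auto
    also have "\<dots> = 1 / x" by (simp add: power2_eq_square)
    also have "\<dots> \<le> 1 / m" using x m by (intro divide_left_mono) auto
    finally have "\<bar>err d (s - t) v\<bar> \<le> 1 / m" .
    moreover have "0 \<le> d\<^sup>2 / (2 * m ^ 3 * T\<^sup>2)" using m by simp
    ultimately show ?thesis using i by simp
  qed
qed

section \<open>Measurability and total masses of the kernels\<close>

lemma measurable_ident_M [measurable]: "(\<lambda>s. s) \<in> borel_measurable M"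
  using id_borel_measurable_lebesgue_on by (simp add: id_def)

lemma measurable_kernels [measurable]:
  "(\<lambda>s. pker \<sigma> (s - t)) \<in> borel_measurable M" "(\<lambda>s. pker \<sigma> (s + t)) \<in> borel_measurable M"
  "(\<lambda>s. qker \<sigma> (s - t)) \<in> borel_measurable M" "(\<lambda>s. qker \<sigma> (s + t)) \<in> borel_measurable M"
  "(\<lambda>s. err d (s - t) (s - t)) \<in> borel_measurable M" "(\<lambda>s. err d (s - t) (s + t)) \<in> borel_measurable M"
  unfolding pker_def qker_def err_def by measurable

text \<open>The kernel has the antiderivative (T/pi) arctan(sin(\<open>ha u\<close>)/\<sigma>). At s
  = 0 the contributions of s - t and s + t cancel; at s = T both sines equal
  cos(\<open>ha t\<close>) > 0, so each arctangent tends to pi/2.\<close>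

lemma pker_mass:
  assumes t: "t \<in> {0<..<T}"
  shows "((\<lambda>d. \<integral>s. pker (d / T) (s - t) + pker (d / T) (s + t) \<partial>M) \<longlongrightarrow> T) (at_right 0)"
proof -
  note c = sin_cos_ha_pos(2)[OF t]
  have eq: "(\<integral>s. pker \<sigma> (s - t) + pker \<sigma> (s + t) \<partial>M) = 2 * T / pi * arctan (cos (ha t) / \<sigma>)" if \<sigma>: "0 < \<sigma>" for \<sigma>
  proof -
    have D: "\<sigma>\<^sup>2 + (sin x)\<^sup>2 \<noteq> 0" for x using \<sigma> by (metis add_pos_nonneg less_irrefl zero_le_power2 zero_less_power)
    have der: "((\<lambda>s. T / pi * arctan (sin (ha (s + r)) / \<sigma>)) has_field_derivative pker \<sigma> (s + r)) (at s within A)" for s r A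
    proof -
      have "((\<lambda>s. T / pi * arctan (sin (ha (s + r)) / \<sigma>)) has_field_derivative
         T / pi * (inverse (1 + (sin (ha (s + r)) / \<sigma>)\<^sup>2) * (cos (ha (s + r)) * (pi * (1 / (2 * T))) / \<sigma>))) (at s within A)"
        using T \<sigma> by (auto intro!: derivative_eq_intros simp: inverse_eq_divide)
      moreover have "T / pi * (inverse (1 + (sin (ha (s + r)) / \<sigma>)\<^sup>2) * (cos (ha (s + r)) * (pi * (1 / (2 * T))) / \<sigma>)) = pker \<sigma> (s + r)"
      proof -
        have "inverse (1 + (sin (ha (s + r)) / \<sigma>)\<^sup>2) = \<sigma>\<^sup>2 / (\<sigma>\<^sup>2 + (sin (ha (s + r)))\<^sup>2)"
          using \<sigma> by (simp add: power_divide add_divide_eq_iff inverse_eq_divide)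
        then show ?thesis using T \<sigma> D[of "ha (s + r)"]
          by (simp only: pker_def) (simp add: power2_eq_square)
      qed
      ultimately show ?thesis by simp
    qed
    have cont: "continuous_on {0..T} (\<lambda>s. pker \<sigma> (s - t) + pker \<sigma> (s + t))"
      unfolding pker_def by (intro continuous_intros ballI) (use D T in \<open>simp_all del: distrib_left_numeral\<close>)
    have "(\<integral>s. pker \<sigma> (s - t) + pker \<sigma> (s + t) \<partial>M)
      = (T / pi * arctan (sin (ha (T + - t)) / \<sigma>) + T / pi * arctan (sin (ha (T + t)) / \<sigma>))
      - (T / pi * arctan (sin (ha (0 + - t)) / \<sigma>) + T / pi * arctan (sin (ha (0 + t)) / \<sigma>))"
      by (rule integral_lebesgue_on_FTC[OF _ cont]) (use T der[of "- t"] der[of t] in \<open>auto intro!: DERIV_add\<close>)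
    also have "sin (ha (T + t)) = cos (ha t)"
      unfolding ha_add using T by (simp add: sin_add)
    also have "sin (ha (T + - t)) = cos (ha t)"
      using T unfolding ha_add sin_add by simp
    also have "sin (ha (0 + - t)) = - sin (ha t)" by simp
    finally show ?thesis by (simp add: arctan_minus)
  qed
  have "filterlim (\<lambda>d. cos (ha t) * T / d) at_top (at_right 0)"
  proof -
    have "filterlim (\<lambda>d::real. inverse d) at_top (at_right 0)" by (rule filterlim_inverse_at_top_right)
    then have "filterlim (\<lambda>d. cos (ha t) * T * inverse d) at_top (at_right 0)"
      by (intro filterlim_tendsto_pos_mult_at_top[OF tendsto_const]) (use c T in auto)
    then show ?thesis by (simp only: divide_inverse)
  qed
  then have "((\<lambda>d. arctan (cos (ha t) * T / d)) \<longlongrightarrow> pi / 2) (at_right 0)"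
    by (rule filterlim_compose[OF tendsto_arctan_at_top])
  then have "((\<lambda>d. 2 * T / pi * arctan (cos (ha t) * T / d)) \<longlongrightarrow> 2 * T / pi * (pi / 2)) (at_right 0)"
    by (rule tendsto_mult_left)
  then have "((\<lambda>d. 2 * T / pi * arctan (cos (ha t) * T / d)) \<longlongrightarrow> T) (at_right 0)" by simp
  then show ?thesis
  proof (rule Lim_transform_eventually)
    show "eventually (\<lambda>d. 2 * T / pi * arctan (cos (ha t) * T / d) = (\<integral>s. pker (d / T) (s - t) + pker (d / T) (s + t) \<partial>M)) (at_right 0)"
      using eventually_at_right_less by (rule eventually_mono) (use T in \<open>simp add: eq\<close>)
  qed
qed

lemma integrable_err:
  assumes d: "0 < d" "d < T" and t: "t \<in> {0<..<T}"
  shows "integrable M (\<lambda>s. err d (s - t) (s - t))" "integrable M (\<lambda>s. err d (s - t) (s + t))"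
proof -
  have le: "T * (d / (d\<^sup>2 + u\<^sup>2)) \<le> T * (d / d\<^sup>2)" for u
    using d T by (intro mult_left_mono divide_left_mono mult_pos_pos) (auto simp: add_pos_nonneg)
  have b: "\<bar>err d (s - t) (s - t)\<bar> \<le> T * (d / d\<^sup>2)" "\<bar>err d (s - t) (s + t)\<bar> \<le> T * (d / d\<^sup>2)" if s: "s \<in> {0<..<T}" for s
  proof -
    have g: "\<bar>s - t\<bar> / T \<le> \<bar>sin (ha (s - t))\<bar>" using s t by (intro sin_ha_ge) auto
    moreover have "\<bar>s - t\<bar> / T \<le> \<bar>sin (ha (s + t))\<bar>" using g sin_ha_diff_le[OF s t] by linarith
    ultimately show "\<bar>err d (s - t) (s - t)\<bar> \<le> T * (d / d\<^sup>2)" "\<bar>err d (s - t) (s + t)\<bar> \<le> T * (d / d\<^sup>2)"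
      using order_trans[OF err_bound[OF d] le] by blast+
  qed
  show "integrable M (\<lambda>s. err d (s - t) (s - t))" "integrable M (\<lambda>s. err d (s - t) (s + t))"
    by (rule integrable_const_bound[where B = "T * (d / d\<^sup>2)"]; use b in \<open>auto intro!: AE_I2\<close>)+
qed

text \<open>Over the largest interval symmetric about t inside (0,T), of radius \<eta>, the odd
  error integrates to 0; outside it the majorant is at most T d/\<eta>^2.\<close>

lemma integral_err_diff_tendsto_0:
  assumes t: "t \<in> {0<..<T}"
  shows "((\<lambda>d. \<integral>s. err d (s - t) (s - t) \<partial>M) \<longlongrightarrow> 0) (at_right 0)"
proof (rule Lim_null_comparison)
  define \<eta> where "\<eta> = min t (T - t)"
  have \<eta>: "0 < \<eta>" using t by (simp add: \<eta>_def)
  have "((\<lambda>d. T * (d / \<eta>\<^sup>2) * T) \<longlongrightarrow> T * (0 / \<eta>\<^sup>2) * T) (at_right 0)"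
    by (intro tendsto_intros) (use \<eta> in simp)
  then show "((\<lambda>d. T * (d / \<eta>\<^sup>2) * T) \<longlongrightarrow> 0) (at_right 0)" by simp
  have "eventually (\<lambda>d. d \<in> {0<..<T}) (at_right 0)"
    by (rule eventually_at_rightI[of _ T]) (use T in auto)
  then show "eventually (\<lambda>d. norm (\<integral>s. err d (s - t) (s - t) \<partial>M) \<le> T * (d / \<eta>\<^sup>2) * T) (at_right 0)"
  proof eventually_elim
    case (elim d)
    then have d: "0 < d" "d < T" by auto
    let ?F = "\<lambda>s. err d (s - t) (s - t)" and ?J = "{t-\<eta><..<t+\<eta>}"
    have Fi: "integrable M ?F" by (rule integrable_err[OF d t])
    have odd: "err d (- u) (- u) = - err d u u" for u by (simp add: err_def qker_def)
    have [measurable]: "indicat_real ?J \<in> borel_measurable M"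
      by (rule measurable_restrict_space1, rule borel_measurable_indicator) simp
    have Ji: "integrable M (\<lambda>s. indicator ?J s * ?F s)"
      by (rule Bochner_Integration.integrable_bound[OF Fi]) (auto split: split_indicator)
    define G where "G s = indicator ?J s * ?F s" for s
    have J0: "(\<integral>s. G s \<partial>M) = 0"
    proof -
      have J: "?J \<subseteq> {0<..<T}" by (auto simp: \<eta>_def)
      have "(\<integral>s. G s \<partial>M) = (\<integral>s. indicator {0<..<T} s *\<^sub>R G s \<partial>lebesgue)"
        by (rule integral_restrict_space) simp
      also have "(\<lambda>s. indicator {0<..<T} s *\<^sub>R G s) = G"
        by (rule ext) (use J in \<open>auto simp: G_def split: split_indicator\<close>)
      finally have GM: "(\<integral>s. G s \<partial>M) = (\<integral>s. G s \<partial>lebesgue)" .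
      \<comment> \<open>Reflection about t, written as an affine map with slope -1 to match the
        change of variables used next.\<close>
      have "G (2 * t + - 1 * x) = - G x" for x
        using odd[of "x - t"] by (auto simp: G_def algebra_simps split: split_indicator)
      then have "(\<integral>s. G s \<partial>lebesgue) = - (\<integral>s. G s \<partial>lebesgue)"
        using lebesgue_integral_real_affine[of "- 1" G "2 * t"] by simp
      then show ?thesis using GM by simp
    qed
    have "(\<integral>s. ?F s - G s \<partial>M) = (\<integral>s. ?F s \<partial>M) - (\<integral>s. G s \<partial>M)"
      by (rule Bochner_Integration.integral_diff) (use Fi Ji in \<open>auto simp: G_def\<close>)
    then have "norm (\<integral>s. ?F s \<partial>M) = norm (\<integral>s. ?F s - G s \<partial>M)" using J0 by simp
    also have "\<dots> \<le> (\<integral>s. norm (?F s - G s) \<partial>M)" by (rule integral_norm_bound)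
    also have "\<dots> \<le> (\<integral>s. T * (d / \<eta>\<^sup>2) \<partial>M)"
    proof (rule integral_mono)
      show "integrable M (\<lambda>s. norm (?F s - G s))"
        using Fi Ji by (intro integrable_norm Bochner_Integration.integrable_diff) (auto simp: G_def)
      fix s assume "s \<in> space M"
      then have s: "s \<in> {0<..<T}" by simp
      show "norm (?F s - G s) \<le> T * (d / \<eta>\<^sup>2)"
      proof (cases "s \<in> ?J")
        case True
        then show ?thesis using d T by (simp add: G_def)
      next
        case False
        then have "\<eta> \<le> \<bar>s - t\<bar>" by auto
        then have "\<eta>\<^sup>2 \<le> (s - t)\<^sup>2" using \<eta> by (intro abs_le_square_iff[THEN iffD1]) auto
        then have le: "T * (d / (d\<^sup>2 + (s - t)\<^sup>2)) \<le> T * (d / \<eta>\<^sup>2)"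
          using d T \<eta> by (intro mult_left_mono divide_left_mono mult_pos_pos) (auto simp: add_pos_nonneg intro: add_increasing)
        have "\<bar>?F s\<bar> \<le> T * (d / (d\<^sup>2 + (s - t)\<^sup>2))"
          using s t by (intro err_bound[OF d] sin_ha_ge) auto
        then show ?thesis using False le by (simp add: G_def)
      qed
    qed simp
    also have "\<dots> = T * (d / \<eta>\<^sup>2) * T" using T by (simp add: measure_restrict_space)
    finally show ?case .
  qed
qed

lemma integral_err_add_tendsto_0:
  assumes t: "t \<in> {0<..<T}"
  shows "((\<lambda>d. \<integral>s. err d (s - t) (s + t) \<partial>M) \<longlongrightarrow> 0) (at_right 0)"
proof (rule Lim_null_comparison)
  define m where "m = min (sin (ha t)) (cos (ha t))"
  have m: "0 < m" using sin_cos_ha_pos[OF t] by (simp add: m_def)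
  let ?B = "\<lambda>d. d\<^sup>2 / (2 * m ^ 3 * T\<^sup>2) * T + 1 / m * (2 * d)"
  have "(?B \<longlongrightarrow> 0\<^sup>2 / (2 * m ^ 3 * T\<^sup>2) * T + 1 / m * (2 * 0)) (at_right 0)"
    by (intro tendsto_intros) (use m T in simp_all)
  then show "(?B \<longlongrightarrow> 0) (at_right 0)" by simp
  have "eventually (\<lambda>d. d \<in> {0<..<T}) (at_right 0)"
    by (rule eventually_at_rightI[of _ T]) (use T in auto)
  then show "eventually (\<lambda>d. norm (\<integral>s. err d (s - t) (s + t) \<partial>M) \<le> ?B d) (at_right 0)"
  proof eventually_elim
    case (elim d)
    then have d: "0 < d" "d < T" by auto
    let ?F = "\<lambda>s. err d (s - t) (s + t)" and ?J = "{t-d..t+d}"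
    have Fi: "integrable M ?F" by (rule integrable_err[OF d t])
    have Jm [measurable]: "indicat_real ?J \<in> borel_measurable M"
      by (rule measurable_restrict_space1, rule borel_measurable_indicator) simp
    have Ji: "integrable M (indicat_real ?J)"
      by (rule integrable_const_bound[where B = 1]) (auto split: split_indicator)
    have J: "(\<integral>s. indicat_real ?J s \<partial>M) \<le> 2 * d"
    proof -
      have "(\<integral>s. indicat_real ?J s \<partial>M) = (\<integral>s. indicator {0<..<T} s *\<^sub>R indicat_real ?J s \<partial>lebesgue)"
        by (rule integral_restrict_space) simp
      also have "\<dots> \<le> (\<integral>s. indicat_real ?J s \<partial>lebesgue)"
        by (rule integral_mono') (use d in \<open>auto split: split_indicator\<close>)
      also have "\<dots> = 2 * d" using d by simp
      finally show ?thesis .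
    qed
    have "norm (\<integral>s. ?F s \<partial>M) \<le> (\<integral>s. norm (?F s) \<partial>M)" by (rule integral_norm_bound)
    also have "\<dots> \<le> (\<integral>s. d\<^sup>2 / (2 * m ^ 3 * T\<^sup>2) + 1 / m * indicator ?J s \<partial>M)"
    proof (rule integral_mono)
      fix s assume "s \<in> space M"
      then have s: "s \<in> {0<..<T}" by simp
      show "norm (?F s) \<le> d\<^sup>2 / (2 * m ^ 3 * T\<^sup>2) + 1 / m * indicator ?J s"
        using err_bound_away[OF d m, of "s + t" s t] sin_ha_add_ge[OF s t] by (simp add: m_def)
    qed (use Fi Ji in auto)
    also have "\<dots> = (\<integral>s. d\<^sup>2 / (2 * m ^ 3 * T\<^sup>2) \<partial>M) + (\<integral>s. 1 / m * indicator ?J s \<partial>M)"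
      by (rule Bochner_Integration.integral_add) (use Ji in auto)
    also have "(\<integral>s. d\<^sup>2 / (2 * m ^ 3 * T\<^sup>2) \<partial>M) = d\<^sup>2 / (2 * m ^ 3 * T\<^sup>2) * T"
      using T by (simp add: measure_restrict_space)
    also have "(\<integral>s. 1 / m * indicator ?J s \<partial>M) \<le> 1 / m * (2 * d)"
      unfolding integral_mult_right_zero using J m by (intro mult_left_mono) auto
    finally show ?case by simp
  qed
qed

end

subsection \<open>Convergence of the truncated integrals\<close>

context Hilbert_interval
begin

abbreviation Lebesgue_point :: "(real \<Rightarrow> real) \<Rightarrow> real \<Rightarrow> bool" where
  "Lebesgue_point f t \<equiv> ((\<lambda>r. (\<integral>s. indicator {t-r..t+r} s * \<bar>f s - f t\<bar> \<partial>M) / r) \<longlongrightarrow> 0) (at_right 0)"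

text \<open>The \<sigma> \<rightarrow> 0 limit of the two conjugate kernels, cut off near t. The
  regular summand is cut off as well, because the principal value truncates the whole
  integrand.\<close>

definition trunc_ker :: "real \<Rightarrow> real \<Rightarrow> real \<Rightarrow> real" where
  "trunc_ker t d s = (if d < \<bar>s - t\<bar> then 1 / (2 * sin (ha (s - t))) + 1 / (2 * sin (ha (s + t))) else 0)"

lemma sin_ha_lower:
  assumes "s \<in> {0<..<T}" "t \<in> {0<..<T}"
  shows "\<bar>s - t\<bar> / T \<le> \<bar>sin (ha (s - t))\<bar>" "\<bar>s - t\<bar> / T \<le> \<bar>sin (ha (s + t))\<bar>"
proof -
  show g: "\<bar>s - t\<bar> / T \<le> \<bar>sin (ha (s - t))\<bar>" using assms by (intro sin_ha_ge) auto
  show "\<bar>s - t\<bar> / T \<le> \<bar>sin (ha (s + t))\<bar>" using g sin_ha_diff_le[OF assms] by linarith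
qed

lemma Poisson_integral_tendsto:
  assumes h: "integrable M h" and t: "t \<in> {0<..<T}" and leb: "Lebesgue_point h t"
  shows "((\<lambda>d. \<integral>s. h s * (pker (d / T) (s - t) + pker (d / T) (s + t)) \<partial>M) \<longlongrightarrow> T * h t) (at_right 0)"
proof (rule Lebesgue_point_approximate_identity[OF h leb _ T _ pker_mass[OF t]])
  show "(\<lambda>s. pker (d / T) (s - t) + pker (d / T) (s + t)) \<in> borel_measurable M" for d by measurable
  fix d s :: real assume d: "0 < d" and s: "s \<in> {0<..<T}"
  show "\<bar>pker (d / T) (s - t) + pker (d / T) (s + t)\<bar> \<le> T * (d / (d\<^sup>2 + (s - t)\<^sup>2))"
    using pker_bound[OF d sin_ha_lower(1)[OF s t]] pker_bound[OF d sin_ha_lower(2)[OF s t]] by linarith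
qed

lemma conjugate_error_tendsto:
  assumes \<phi>: "integrable M \<phi>" and t: "t \<in> {0<..<T}" and leb: "Lebesgue_point \<phi> t"
  shows "((\<lambda>d. \<integral>s. \<phi> s * (err d (s - t) (s - t) + err d (s - t) (s + t)) \<partial>M) \<longlongrightarrow> 0) (at_right 0)"
proof -
  have "((\<lambda>d. (\<integral>s. err d (s - t) (s - t) \<partial>M) + (\<integral>s. err d (s - t) (s + t) \<partial>M)) \<longlongrightarrow> 0 + 0) (at_right 0)"
    by (intro tendsto_add integral_err_diff_tendsto_0 integral_err_add_tendsto_0 t)
  moreover have "eventually (\<lambda>d. (\<integral>s. err d (s - t) (s - t) \<partial>M) + (\<integral>s. err d (s - t) (s + t) \<partial>M)
      = (\<integral>s. err d (s - t) (s - t) + err d (s - t) (s + t) \<partial>M)) (at_right 0)"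
    by (rule eventually_at_rightI[of _ T])
       (use T integrable_err[OF _ _ t] in \<open>auto intro!: Bochner_Integration.integral_add[symmetric]\<close>)
  ultimately have lim: "((\<lambda>d. \<integral>s. err d (s - t) (s - t) + err d (s - t) (s + t) \<partial>M) \<longlongrightarrow> 0 + 0) (at_right 0)"
    by (rule Lim_transform_eventually)
  have "((\<lambda>d. \<integral>s. \<phi> s * (err d (s - t) (s - t) + err d (s - t) (s + t)) \<partial>M) \<longlongrightarrow> (0 + 0) * \<phi> t) (at_right 0)"
  proof (rule Lebesgue_point_approximate_identity[OF \<phi> leb _ T _ lim])
    show "(\<lambda>s. err d (s - t) (s - t) + err d (s - t) (s + t)) \<in> borel_measurable M" for d by measurable
    fix d s :: real assume d: "0 < d" "d < T" and s: "s \<in> {0<..<T}"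
    show "\<bar>err d (s - t) (s - t) + err d (s - t) (s + t)\<bar> \<le> 2 * T * (d / (d\<^sup>2 + (s - t)\<^sup>2))"
      using err_bound[OF d sin_ha_lower(1)[OF s t]] err_bound[OF d sin_ha_lower(2)[OF s t]]
      by linarith
  qed
  then show ?thesis by simp
qed

text \<open>Beyond the cut-off both sines exceed d/T in absolute value, so the kernel is bounded by
  T/d.\<close>

lemma integrable_trunc_ker:
  assumes \<phi>: "integrable M \<phi>" and t: "t \<in> {0<..<T}" and d: "0 < d"
  shows "integrable M (\<lambda>s. \<phi> s * trunc_ker t d s)"
proof (rule Bochner_Integration.integrable_bound)
  show "integrable M (\<lambda>s. \<phi> s * (T / d))" using \<phi> by (rule integrable_mult_left)
  have [measurable]: "\<phi> \<in> borel_measurable M" using \<phi> by simp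
  show "(\<lambda>s. \<phi> s * trunc_ker t d s) \<in> borel_measurable M"
    unfolding trunc_ker_def by measurable
  have inv: "\<bar>1 / (2 * x)\<bar> \<le> T / d / 2" if "\<bar>s - t\<bar> / T \<le> \<bar>x\<bar>" "d < \<bar>s - t\<bar>" for x s
  proof -
    have "d / T < \<bar>s - t\<bar> / T" using that T by (simp add: divide_strict_right_mono)
    moreover have dT: "0 < d / T" using d T by simp
    ultimately have "d / T \<le> \<bar>x\<bar>" "0 < \<bar>x\<bar>" using that(1) by linarith+
    with dT have "1 / \<bar>x\<bar> \<le> 1 / (d / T)" by (intro divide_left_mono mult_pos_pos) auto
    then show ?thesis by (simp add: abs_mult)
  qed
  show "AE s in M. norm (\<phi> s * trunc_ker t d s) \<le> norm (\<phi> s * (T / d))"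
  proof (rule AE_I2)
    fix s assume "s \<in> space M"
    then have s: "s \<in> {0<..<T}" by simp
    have "\<bar>trunc_ker t d s\<bar> \<le> \<bar>T / d\<bar>"
    proof (cases "d < \<bar>s - t\<bar>")
      case True
      have half: "\<bar>x + y\<bar> \<le> c" if "\<bar>x\<bar> \<le> c / 2" "\<bar>y\<bar> \<le> c / 2" for x y c :: real
        using that by linarith
      have "\<bar>trunc_ker t d s\<bar> \<le> T / d"
        using half[OF inv[OF sin_ha_lower(1)[OF s t] True] inv[OF sin_ha_lower(2)[OF s t] True]] True
        unfolding trunc_ker_def by (simp only: if_True)
      then show ?thesis by linarith
    next
      case False
      then show ?thesis by (simp add: trunc_ker_def)
    qed
    then show "norm (\<phi> s * trunc_ker t d s) \<le> norm (\<phi> s * (T / d))"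
      unfolding real_norm_def abs_mult by (rule mult_left_mono) simp
  qed
qed

lemma truncated_integral_tendsto:
  assumes \<phi>: "\<phi> \<in> L2_space T" and h: "L2_sums T (\<lambda>k t. sine_coeff T \<phi> k * cos (ang k t)) h"
    and t: "t \<in> {0<..<T}" and leb: "Lebesgue_point \<phi> t" "Lebesgue_point h t"
  shows "((\<lambda>d. \<integral>s. \<phi> s * trunc_ker t d s \<partial>M) \<longlongrightarrow> T * h t) (at_right 0)"
proof -
  have "h \<in> L2_space T" using h by (simp add: L2_sums_def)
  then have hi: "integrable M h" by (rule L2D)
  note \<phi>i = L2D(3)[OF \<phi>]
  have "((\<lambda>d. (\<integral>s. h s * (pker (d / T) (s - t) + pker (d / T) (s + t)) \<partial>M)
      - (\<integral>s. \<phi> s * (err d (s - t) (s - t) + err d (s - t) (s + t)) \<partial>M)) \<longlongrightarrow> T * h t - 0) (at_right 0)"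
    by (intro tendsto_diff Poisson_integral_tendsto[OF hi t leb(2)] conjugate_error_tendsto[OF \<phi>i t leb(1)])
  moreover have "eventually (\<lambda>d. (\<integral>s. h s * (pker (d / T) (s - t) + pker (d / T) (s + t)) \<partial>M)
      - (\<integral>s. \<phi> s * (err d (s - t) (s - t) + err d (s - t) (s + t)) \<partial>M) = (\<integral>s. \<phi> s * trunc_ker t d s \<partial>M)) (at_right 0)"
    using eventually_at_right_less
  proof (rule eventually_mono)
    fix d :: real assume d: "0 < d"
    let ?q = "\<lambda>s. qker (d / T) (s - t) + qker (d / T) (s + t)"
    have "0 < d / T" using d T by simp
    then have D: "(d / T)\<^sup>2 + (sin x)\<^sup>2 \<noteq> 0" for x
      by (metis add_pos_nonneg less_irrefl zero_le_power2 zero_less_power)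
    have "continuous_on {0..T} ?q"
      unfolding qker_def by (intro continuous_intros ballI) (use D T in \<open>simp_all del: distrib_left_numeral\<close>)
    then have qi: "integrable M (\<lambda>s. \<phi> s * ?q s)" by (intro L2_mult \<phi> continuous_L2)
    have e: "err d (s - t) (s - t) + err d (s - t) (s + t) = ?q s - trunc_ker t d s" for s
      by (simp add: err_def trunc_ker_def)
    have "(\<integral>s. \<phi> s * (err d (s - t) (s - t) + err d (s - t) (s + t)) \<partial>M)
        = (\<integral>s. \<phi> s * ?q s \<partial>M) - (\<integral>s. \<phi> s * trunc_ker t d s \<partial>M)"
      unfolding e right_diff_distrib by (rule Bochner_Integration.integral_diff[OF qi integrable_trunc_ker[OF \<phi>i t d]])
    then show "(\<integral>s. h s * (pker (d / T) (s - t) + pker (d / T) (s + t)) \<partial>M)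
      - (\<integral>s. \<phi> s * (err d (s - t) (s - t) + err d (s - t) (s + t)) \<partial>M) = (\<integral>s. \<phi> s * trunc_ker t d s \<partial>M)"
      using Poisson_eq_conjugate_Poisson[OF \<phi> \<open>0 < d / T\<close> h, of t] by simp
  qed
  ultimately have "((\<lambda>d. \<integral>s. \<phi> s * trunc_ker t d s \<partial>M) \<longlongrightarrow> T * h t - 0) (at_right 0)"
    by (rule Lim_transform_eventually)
  then show ?thesis by simp
qed

text \<open>The difference of squared cosines factors as minus the product of the two sines, whose
  sum is 2 sin(\<open>ha s\<close>) cos(\<open>ha t\<close>). The remaining factor
  1/cos(\<open>ha t\<close>) is free of s and cancels against the prefactor of the formula.\<close>

lemma kernel_eq:
  assumes s: "s \<in> {0<..<T}" and t: "t \<in> {0<..<T}" and d: "0 < d" "d < \<bar>s - t\<bar>"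
  shows "sin (ha s) / ((cos (ha s))\<^sup>2 - (cos (ha t))\<^sup>2) = - (1 / cos (ha t)) * trunc_ker t d s"
proof -
  have pos: "0 < \<bar>s - t\<bar> / T" using d T by simp
  have x: "sin (ha (s - t)) \<noteq> 0" and y: "sin (ha (s + t)) \<noteq> 0"
    using sin_ha_lower[OF s t] pos by auto
  have c: "cos (ha t) \<noteq> 0" using sin_cos_ha_pos(2)[OF t] by simp
  have 1: "(cos (ha s))\<^sup>2 - (cos (ha t))\<^sup>2 = - (sin (ha (s - t)) * sin (ha (s + t)))"
  proof -
    have "sin (ha (s - t)) * sin (ha (s + t)) = (sin (ha s))\<^sup>2 * (cos (ha t))\<^sup>2 - (cos (ha s))\<^sup>2 * (sin (ha t))\<^sup>2"
      unfolding ha_add ha_diff sin_add sin_diff by (simp add: algebra_simps power2_eq_square)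
    then show ?thesis unfolding sin_squared_eq by (simp add: algebra_simps)
  qed
  have 2: "sin (ha (s - t)) + sin (ha (s + t)) = 2 * sin (ha s) * cos (ha t)"
    unfolding ha_add ha_diff sin_add sin_diff by simp
  have "trunc_ker t d s = (sin (ha (s - t)) + sin (ha (s + t))) / (2 * (sin (ha (s - t)) * sin (ha (s + t))))"
    using x y d(2) by (simp only: trunc_ker_def if_True) (simp add: add_frac_eq field_simps)
  then show ?thesis using c unfolding 1 2 by simp
qed

lemma has_pv_integral_Hilbert:
  assumes \<phi>: "\<phi> \<in> L2_space T" and h: "L2_sums T (\<lambda>k t. sine_coeff T \<phi> k * cos (ang k t)) h"
    and t: "t \<in> {0<..<T}" and leb: "Lebesgue_point \<phi> t" "Lebesgue_point h t"
  shows "has_pv_integral (\<lambda>s. \<phi> s * (sin (ha s) / ((cos (ha s))\<^sup>2 - (cos (ha t))\<^sup>2)))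
    (- (1 / cos (ha t)) * (T * h t)) {0<..<T} t"
proof -
  let ?f = "\<lambda>s. \<phi> s * (sin (ha s) / ((cos (ha s))\<^sup>2 - (cos (ha t))\<^sup>2))"
  let ?S = "\<lambda>d. {s \<in> {0<..<T}. d < \<bar>s - t\<bar>}"
  have Sm: "?S d \<in> sets lebesgue" for d
  proof -
    have "?S d = {0<..<T} - {t-d..t+d}" by auto
    then show ?thesis by simp
  qed
  \<comment> \<open>Extended by zero, both integrands are functions on the whole line. The cut-off
    built into \<open>trunc_ker\<close> replaces the restricted domain, so integrals over varying
    sets become integrals over the fixed interval.\<close>
  have eq: "indicator (?S d) s *\<^sub>R ?f s = indicator {0<..<T} s *\<^sub>R (- (1 / cos (ha t)) * (\<phi> s * trunc_ker t d s))"
    if "0 < d" for d s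
  proof (cases "s \<in> ?S d")
    case True
    then have *: "s \<in> {0<..<T}" "d < \<bar>s - t\<bar>" by simp_all
    have "\<phi> s * (- (1 / cos (ha t)) * trunc_ker t d s) = - (1 / cos (ha t)) * (\<phi> s * trunc_ker t d s)"
      by (rule mult.left_commute)
    then show ?thesis unfolding kernel_eq[OF *(1) t that *(2)] using True by simp
  next
    case False
    then show ?thesis by (auto simp: trunc_ker_def indicator_def)
  qed
  have i: "integrable M (\<lambda>s. - (1 / cos (ha t)) * (\<phi> s * trunc_ker t d s))" if "0 < d" for d
    by (intro integrable_mult_right integrable_trunc_ker L2D(3)[OF \<phi>] t that)
  have int: "integrable (lebesgue_on (?S d)) ?f" if d: "0 < d" for d
  proof -
    have r: "integrable (lebesgue_on A) g \<longleftrightarrow> integrable lebesgue (\<lambda>s. indicator A s *\<^sub>R g s)"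
      if "A \<in> sets lebesgue" for A and g :: "real \<Rightarrow> real"
      by (rule integrable_restrict_space) (use that in simp)
    have "{0<..<T} \<in> sets lebesgue" by simp
    from i[OF d, unfolded r[OF this]] show ?thesis unfolding r[OF Sm] eq[OF d] .
  qed
  have val: "(\<integral>s. ?f s \<partial>lebesgue_on (?S d)) = - (1 / cos (ha t)) * (\<integral>s. \<phi> s * trunc_ker t d s \<partial>M)" if d: "0 < d" for d
  proof -
    have "(\<integral>s. ?f s \<partial>lebesgue_on (?S d)) = (\<integral>s. indicator (?S d) s *\<^sub>R ?f s \<partial>lebesgue)"
      by (rule integral_restrict_space) (use Sm in simp)
    also have "\<dots> = (\<integral>s. - (1 / cos (ha t)) * (\<phi> s * trunc_ker t d s) \<partial>M)"
      unfolding eq[OF d] by (rule integral_restrict_space[symmetric]) simp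
    finally show ?thesis unfolding integral_mult_right_zero .
  qed
  have "((\<lambda>d. - (1 / cos (ha t)) * (\<integral>s. \<phi> s * trunc_ker t d s \<partial>M)) \<longlongrightarrow> - (1 / cos (ha t)) * (T * h t)) (at_right 0)"
    by (intro tendsto_mult_left truncated_integral_tendsto[OF \<phi> h t leb])
  then have "((\<lambda>d. \<integral>s. ?f s \<partial>lebesgue_on (?S d)) \<longlongrightarrow> - (1 / cos (ha t)) * (T * h t)) (at_right 0)"
    by (rule Lim_transform_eventually)
       (rule eventually_mono[OF eventually_at_right_less], simp only: val)
  then show ?thesis unfolding has_pv_integral_def using int by blast
qed

end

theorem mainTheorem3:
  fixes T :: real and \<phi> :: "real \<Rightarrow> real"
  assumes "T > 0" and "\<phi> \<in> L2_space T"
  shows "AE t in lebesgue_on {0<..<T}. \<exists>I.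
           has_pv_integral
             (\<lambda>s. \<phi> s * (sin (pi * (s / (2 * T))) /
                     ((cos (pi * (s / (2 * T))))\<^sup>2 - (cos (pi * (t / (2 * T))))\<^sup>2)))
             I {0<..<T} t \<and>
           modified_Hilbert T \<phi> t = - (cos (pi * (t / (2 * T))) / T) * I"
proof -
  interpret Hilbert_interval T by unfold_locales (rule assms(1))
  \<comment> \<open>This is the very representative picked by the choice operator. The exceptional
    set is built from its own Lebesgue points and those of \<phi>, so the pointwise value
    \<open>h t\<close> is determined by averages off that set.\<close>
  define h where "h = modified_Hilbert T \<phi>"
  have h: "L2_sums T (\<lambda>k t. sine_coeff T \<phi> k * cos (ang k t)) h"
    unfolding h_def modified_Hilbert_def by (rule someI_ex[OF cosine_series_converges[OF assms(2)]])
  then have "h \<in> L2_space T" by (simp add: L2_sums_def)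
  then have "AE t in M. Lebesgue_point h t" by (intro AE_Lebesgue_point L2D(3))
  moreover have "AE t in M. Lebesgue_point \<phi> t" by (intro AE_Lebesgue_point L2D(3) assms(2))
  moreover have "AE t in M. t \<in> {0<..<T}" by (rule AE_I2) simp
  ultimately show ?thesis
  proof eventually_elim
    case (elim t)
    have "0 < cos (ha t)" by (rule sin_cos_ha_pos(2)[OF elim(3)])
    then have "h t = - (cos (ha t) / T) * (- (1 / cos (ha t)) * (T * h t))"
      using T by simp
    then show ?case
      using has_pv_integral_Hilbert[OF assms(2) h elim(3,2,1)] unfolding h_def by blast
  qed
qed

end
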